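(* Suppose that $\widetilde P$ is the extended (even-order paired) transition probability tensor, of order $2(m-1)$, of a Markov chain with memory depth $m-1$ on the state space $\mathcal V=\{1,\dots,n\}$ with transition tensor $P=[p_{i_1i_2\cdots i_m}]$. Assume that $\widetilde P$ is U-primitive, i.e. its unfolding $\varphi(\widetilde P)$ is a primitive nonnegative column-stochastic matrix. Then, for any generic initial joint memory distribution $\Pi_0$ (the joint distribution of the initial sequence history), the following statements hold: 1. (Perron U-eigenvalue) The tensor $\widetilde P$ has a unique dominant U-eigenvalue $\lambda_1(\widetilde P)=1$, which is simple and strictly greater in modulus than all other U-eigenvalues. Its corresponding U-eigentensor $\widetilde\Pi>\mathbf 0$ is strictly positive. 2. (Convergence) The sequence of joint probability mass functions $\{\Pi_t\}$ generated by the update rule $$(\Pi_{t+1})_{i_1\cdots i_{m-1}}=\sum_{i_m=1}^n p_{i_1i_2\cdots i_m}(\Pi_t)_{i_2\cdots i_m}$$ converges to the unique limit $\widetilde\Pi$, that is, $\lim_{t\to\infty}\Pi_t=\widetilde\Pi$. 3. (Stationary distribution) The stationary distribution $\tilde x$ of the original Markov chain with memory exists and is given by the marginal sum of $\widetilde\Pi$: $$\tilde x_i=\sum_{i_2,\dots,i_{m-1}}\widetilde\Pi_{i\,i_2\cdots i_{m-1}},\qquad\forall i\in\mathcal V.$$ 4. (Rate of convergence) The asymptotic convergence rate is determined by the modulus of the second largest U-eigenvalue of $\widetilde P$.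
   Context: Markov chain with memory: for $m\ge2$, a process $\{X_t\}$ on $\mathcal V=\{1,\dots,n\}$ with $\Pr(X_{t+1}=i_1\mid X_t=i_2,X_{t-1}=i_3,\dots,X_{t-m+2}=i_m)=p_{i_1i_2\cdots i_m}$, where $p_{i_1\cdots i_m}\ge0$ and $\sum_{i_1=1}^np_{i_1i_2\cdots i_m}=1$ for all $(i_2,\dots,i_m)\in\mathcal V^{m-1}$. (The next state depends on the last $m-1$ states; $m=2$ is a standard first-order chain.) The joint memory distribution at time $t$ is the order-$(m-1)$ tensor $(\Pi_t)_{i_2\cdots i_m}=\Pr(X_t=i_2,X_{t-1}=i_3,\dots,X_{t-m+2}=i_m)$, and the state distribution is $(x_t)_i=\Pr(X_t=i)=\sum_{i_2,\dots,i_{m-1}}(\Pi_t)_{i\,i_2\cdots i_{m-1}}$. Paired transition tensor: for multi-indices $(i_1,\dots,i_{m-1})$ and $(j_1,\dots,j_{m-1})$, $\widetilde P_{i_1j_1i_2j_2\cdots i_{m-1}j_{m-1}}=p_{i_1i_2\cdots i_m}$ if $j_1=i_2,\ j_2=i_3,\ \dots,\ j_{m-1}=i_m$ (so the last index $i_m$ of $p$ is $j_{m-1}$), and $0$ otherwise. Einstein product of an even-order paired tensor $A$ of order $2N$ with an order-$N$ tensor $Y$: $(A\ast Y)_{i_1\cdots i_N}=\sum_{j_1,\dots,j_N}A_{i_1j_1\cdots i_Nj_N}Y_{j_1\cdots j_N}$. The update rule reads $\Pi_{t+1}=\widetilde P\ast\Pi_t$. Unfolding: $\varphi(A)$ is the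 matrix with entries $\varphi(A)_{\mathrm{ivec}(i),\mathrm{ivec}(j)}=A_{i_1j_1\cdots i_Nj_N}$, where $\mathrm{ivec}(i)=i_1+\sum_{k=2}^N(i_k-1)n^{k-1}$ (here $N=m-1$ and all modes have dimension $n$). U-eigenvalue and U-eigentensor of $A$: a scalar $\lambda\in\mathbb C$ and a nonzero complex order-$N$ tensor $X$ with $A\ast X=\lambda X$. $A$ is U-primitive if and only if $\varphi(A)$ is a primitive matrix in the classical sense. The inequality $\widetilde\Pi>\mathbf 0$ is entrywise. As the limit of joint probability mass functions, $\widetilde\Pi$ is understood to be scaled so that its entries sum to $1$. *)

theory Defs
  imports
    "HOL-Probability.Probability_Measure"
    "HOL-Computational_Algebra.Polynomial"
    "Jordan_Normal_Form.Char_Poly"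
begin

text \<open>
  States are the natural numbers \<open>1, \<dots>, n\<close>; a multi-index is a list of states. A tensor of order
  \<open>N\<close> is a function on \<open>midx n N\<close>, and its values on other lists are irrelevant. A paired tensor of
  order \<open>2N\<close>, with entries \<open>A\<^bsub>i1 j1 \<dots> iN jN\<^esub>\<close>, is a function of the two multi-indices
  \<open>[i1, \<dots>, iN]\<close> and \<open>[j1, \<dots>, jN]\<close>.
\<close>

definition midx :: "nat \<Rightarrow> nat \<Rightarrow> nat list set" where
  "midx n N = {is. set is \<subseteq> {1..n} \<and> length is = N}"

definition transition_tensor :: "nat \<Rightarrow> nat \<Rightarrow> (nat list \<Rightarrow> real) \<Rightarrow> bool" where
  "transition_tensor n m p \<longleftrightarrow>
     (\<forall>is\<in>midx n m. p is \<ge> 0) \<and>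
     (\<forall>js\<in>midx n (m - 1). (\<Sum>i=1..n. p (i # js)) = 1)"

definition paired_tensor :: "(nat list \<Rightarrow> real) \<Rightarrow> nat list \<Rightarrow> nat list \<Rightarrow> real" where
  "paired_tensor p is js = (if js = tl is @ [last js] then p (is @ [last js]) else 0)"

definition cplx_tensor :: "(nat list \<Rightarrow> nat list \<Rightarrow> real) \<Rightarrow> nat list \<Rightarrow> nat list \<Rightarrow> complex" where
  "cplx_tensor A is js = complex_of_real (A is js)"

definition einstein ::
  "nat \<Rightarrow> nat \<Rightarrow> (nat list \<Rightarrow> nat list \<Rightarrow> 'a::comm_ring_1) \<Rightarrow> (nat list \<Rightarrow> 'a) \<Rightarrow> nat list \<Rightarrow> 'a" where
  "einstein n N A Y is = (\<Sum>js\<in>midx n N. A is js * Y js)"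

definition U_eigentensor ::
  "nat \<Rightarrow> nat \<Rightarrow> (nat list \<Rightarrow> nat list \<Rightarrow> complex) \<Rightarrow> complex \<Rightarrow> (nat list \<Rightarrow> complex) \<Rightarrow> bool" where
  "U_eigentensor n N A \<mu> X \<longleftrightarrow>
     (\<exists>is\<in>midx n N. X is \<noteq> 0) \<and> (\<forall>is\<in>midx n N. einstein n N A X is = \<mu> * X is)"

definition U_eigenvalue ::
  "nat \<Rightarrow> nat \<Rightarrow> (nat list \<Rightarrow> nat list \<Rightarrow> complex) \<Rightarrow> complex \<Rightarrow> bool" where
  "U_eigenvalue n N A \<mu> \<longleftrightarrow> (\<exists>X. U_eigentensor n N A \<mu> X)"

definition ivec :: "nat \<Rightarrow> nat list \<Rightarrow> nat" where
  "ivec n is = is ! 0 + (\<Sum>k=2..length is. (is ! (k - 1) - 1) * n ^ (k - 1))"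

text \<open>
  \<open>ivec\<close> numbers the multi-indices from 1, whereas matrix rows and columns are counted from 0.
  Hence the entry of the unfolding in row \<open>r\<close> and column \<open>c\<close> belongs to the multi-indices with
  \<open>ivec\<close> equal to \<open>r + 1\<close> and \<open>c + 1\<close>.
\<close>

definition unfolding_mat :: "nat \<Rightarrow> nat \<Rightarrow> (nat list \<Rightarrow> nat list \<Rightarrow> 'a) \<Rightarrow> 'a mat" where
  "unfolding_mat n N A = mat (n ^ N) (n ^ N)
     (\<lambda>(r, c). A (the_inv_into (midx n N) (ivec n) (r + 1)) (the_inv_into (midx n N) (ivec n) (c + 1)))"

lemma ivec_Cons_Cons:
  assumes "a \<ge> 1" "b \<ge> 1"
  shows "ivec n (a # b # bs) = a + n * (ivec n (b # bs) - 1)"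
proof -
  have "(\<Sum>k=2..length (a # b # bs). ((a # b # bs) ! (k - 1) - 1) * n ^ (k - 1))
      = (\<Sum>k=1..length (b # bs). ((b # bs) ! (k - 1) - 1) * n ^ k)"
    by (rule sum.reindex_bij_witness[of _ Suc "\<lambda>k. k - 1"]) auto
  also have "\<dots> = (b - 1) * n + (\<Sum>k=2..length (b # bs). ((b # bs) ! (k - 1) - 1) * n ^ k)"
    by (subst sum.atLeast_Suc_atMost) (auto simp: numeral_2_eq_2)
  also have "(\<Sum>k=2..length (b # bs). ((b # bs) ! (k - 1) - 1) * n ^ k)
      = n * (\<Sum>k=2..length (b # bs). ((b # bs) ! (k - 1) - 1) * n ^ (k - 1))"
    unfolding sum_distrib_left
  proof (rule sum.cong)
    fix k assume "k \<in> {2..length (b # bs)}"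
    then obtain l where "k = Suc l" by (cases k) auto
    then show "((b # bs) ! (k - 1) - 1) * n ^ k = n * (((b # bs) ! (k - 1) - 1) * n ^ (k - 1))"
      by simp
  qed simp
  finally show ?thesis
    using assms by (simp add: ivec_def algebra_simps)
qed

lemma bij_betw_ivec:
  assumes "N \<ge> 1"
  shows "bij_betw (ivec n) (midx n N) {1..n ^ N}"
  using assms
proof (induction N rule: nat_induct_at_least)
  case base
  have "midx n 1 = (\<lambda>i. [i]) ` {1..n}"
    by (auto simp: midx_def length_Suc_conv)
  then show ?case
    by (auto simp: bij_betw_def inj_on_def ivec_def image_image)
next
  case (Suc N)
  have eq: "ivec n (a # bs) = a + n * (ivec n bs - 1)" if "a \<in> {1..n}" "bs \<in> midx n N" for a bs
    using that Suc.hyps by (cases bs) (auto simp: midx_def ivec_Cons_Cons)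
  have rng: "ivec n bs \<in> {1..n ^ N}" if "bs \<in> midx n N" for bs
    using Suc.IH that by (auto simp: bij_betw_def)
  have midx_Suc: "midx n (Suc N) = (\<lambda>(a, bs). a # bs) ` ({1..n} \<times> midx n N)"
    by (fastforce simp: midx_def length_Suc_conv image_iff)
  have inj: "inj_on (ivec n) (midx n (Suc N))"
  proof (rule inj_onI)
    fix xs ys assume "xs \<in> midx n (Suc N)" "ys \<in> midx n (Suc N)" and e: "ivec n xs = ivec n ys"
    then obtain a as b bs where x: "xs = a # as" "a \<in> {1..n}" "as \<in> midx n N"
      and y: "ys = b # bs" "b \<in> {1..n}" "bs \<in> midx n N"
      unfolding midx_Suc by auto
    have "(a - 1) + n * (ivec n as - 1) = (b - 1) + n * (ivec n bs - 1)"
      using e x y by (simp add: eq)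
    moreover have "a - 1 < n" "b - 1 < n" using x y by auto
    moreover have "((u + n * v) mod n, (u + n * v) div n) = (u, v)" if "u < n" for u v
      using that by simp
    ultimately have "(a - 1, ivec n as - 1) = (b - 1, ivec n bs - 1)"
      by metis
    then have "a - 1 = b - 1" "ivec n as - 1 = ivec n bs - 1"
      by simp_all
    then have "a = b" "ivec n as = ivec n bs"
      using x y rng[OF x(3)] rng[OF y(3)] by auto
    then show "xs = ys"
      using x y Suc.IH by (auto simp: bij_betw_def inj_on_def)
  qed
  have sub: "ivec n ` midx n (Suc N) \<subseteq> {1..n ^ Suc N}"
  proof
    fix v assume "v \<in> ivec n ` midx n (Suc N)"
    then obtain a bs where v: "v = a + n * (ivec n bs - 1)" "a \<in> {1..n}" "bs \<in> midx n N"
      unfolding midx_Suc by (auto simp: eq)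
    have "a + n * (ivec n bs - 1) \<le> n + n * (n ^ N - 1)"
      using v rng[OF v(3)] by (intro add_mono mult_left_mono) auto
    also have "\<dots> = n ^ Suc N"
      using v by (cases "n ^ N") auto
    finally show "v \<in> {1..n ^ Suc N}" using v by auto
  qed
  have "card (midx n (Suc N)) = n ^ Suc N"
    unfolding midx_def using card_lists_length_eq[of "{1..n}" "Suc N"] by simp
  then have "card (ivec n ` midx n (Suc N)) = card {1..n ^ Suc N}"
    using inj by (simp add: card_image)
  then have "ivec n ` midx n (Suc N) = {1..n ^ Suc N}"
    using sub by (intro card_subset_eq) auto
  then show ?case using inj by (simp add: bij_betw_def)
qed

lemma unfolding_mat_ivec:
  assumes "N \<ge> 1" "is \<in> midx n N" "js \<in> midx n N"
  shows "unfolding_mat n N A $$ (ivec n is - 1, ivec n js - 1) = A is js"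
proof -
  have b: "ivec n is \<in> {1..n ^ N}" "ivec n js \<in> {1..n ^ N}" and inj: "inj_on (ivec n) (midx n N)"
    using bij_betw_ivec[OF assms(1), of n] assms by (auto simp: bij_betw_def)
  then have "ivec n is - 1 < n ^ N" "ivec n js - 1 < n ^ N" by auto
  then show ?thesis
    using b assms by (simp add: unfolding_mat_def the_inv_into_f_f[OF inj])
qed

definition primitive_mat :: "real mat \<Rightarrow> bool" where
  "primitive_mat B \<longleftrightarrow> square_mat B \<and>
     (\<forall>i<dim_row B. \<forall>j<dim_col B. B $$ (i, j) \<ge> 0) \<and>
     (\<exists>k>0. \<forall>i<dim_row B. \<forall>j<dim_col B. (B ^\<^sub>m k) $$ (i, j) > 0)"

definition U_primitive :: "nat \<Rightarrow> nat \<Rightarrow> (nat list \<Rightarrow> nat list \<Rightarrow> real) \<Rightarrow> bool" where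
  "U_primitive n N A \<longleftrightarrow> primitive_mat (unfolding_mat n N A)"

definition U_simple ::
  "nat \<Rightarrow> nat \<Rightarrow> (nat list \<Rightarrow> nat list \<Rightarrow> complex) \<Rightarrow> complex \<Rightarrow> bool" where
  "U_simple n N A \<mu> \<longleftrightarrow>
     U_eigenvalue n N A \<mu> \<and> Polynomial.order \<mu> (char_poly (unfolding_mat n N A)) = 1"

definition joint_pmf :: "nat \<Rightarrow> nat \<Rightarrow> (nat list \<Rightarrow> real) \<Rightarrow> bool" where
  "joint_pmf n N \<pi> \<longleftrightarrow> (\<forall>is\<in>midx n N. \<pi> is \<ge> 0) \<and> (\<Sum>is\<in>midx n N. \<pi> is) = 1"

definition memory_update ::
  "nat \<Rightarrow> (nat list \<Rightarrow> real) \<Rightarrow> (nat list \<Rightarrow> real) \<Rightarrow> nat list \<Rightarrow> real" where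
  "memory_update n p \<pi> is = (\<Sum>i=1..n. p (is @ [i]) * \<pi> (tl is @ [i]))"

definition memory_dist ::
  "nat \<Rightarrow> (nat list \<Rightarrow> real) \<Rightarrow> (nat list \<Rightarrow> real) \<Rightarrow> nat \<Rightarrow> nat list \<Rightarrow> real" where
  "memory_dist n p \<pi>0 t = (memory_update n p ^^ t) \<pi>0"

definition state_marginal :: "nat \<Rightarrow> nat \<Rightarrow> (nat list \<Rightarrow> real) \<Rightarrow> nat \<Rightarrow> real" where
  "state_marginal n N \<pi> i = (\<Sum>js\<in>midx n (N - 1). \<pi> (i # js))"

text \<open>
  The chain as a process: \<open>X s\<close> is the state at time \<open>s\<close>, for \<open>s \<ge> 2 - m\<close>, so that the memory
  \<open>(X t, X (t - 1), \<dots>, X (t - m + 2))\<close> is available at every time \<open>t \<ge> 0\<close>.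
\<close>

definition memory :: "(int \<Rightarrow> 'a \<Rightarrow> nat) \<Rightarrow> nat \<Rightarrow> nat \<Rightarrow> 'a \<Rightarrow> nat list" where
  "memory X m t \<omega> = map (\<lambda>k. X (int t - int k) \<omega>) [0..<m - 1]"

definition memory_law :: "'a measure \<Rightarrow> (int \<Rightarrow> 'a \<Rightarrow> nat) \<Rightarrow> nat \<Rightarrow> nat \<Rightarrow> nat list \<Rightarrow> real" where
  "memory_law M X m t is = \<P>(\<omega> in M. memory X m t \<omega> = is)"

definition memory_chain ::
  "nat \<Rightarrow> nat \<Rightarrow> (nat list \<Rightarrow> real) \<Rightarrow> 'a measure \<Rightarrow> (int \<Rightarrow> 'a \<Rightarrow> nat) \<Rightarrow> bool" where
  "memory_chain n m p M X \<longleftrightarrow>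
     prob_space M \<and>
     (\<forall>s\<ge>2 - int m. X s \<in> measurable M (count_space {1..n})) \<and>
     (\<forall>t. \<forall>i\<in>{1..n}. \<forall>js\<in>midx n (m - 1). memory_law M X m t js \<noteq> 0 \<longrightarrow>
        \<P>(\<omega> in M. X (int t + 1) \<omega> = i \<bar> memory X m t \<omega> = js) = p (i # js))"

text \<open>
  A state distribution \<open>x\<close> is stationary if the chain, started from a suitable joint distribution of
  its history, has state distribution \<open>x\<close> at all times.
\<close>

definition stationary_distribution ::
  "nat \<Rightarrow> nat \<Rightarrow> (nat list \<Rightarrow> real) \<Rightarrow> (nat \<Rightarrow> real) \<Rightarrow> bool" where
  "stationary_distribution n m p x \<longleftrightarrow>
     (\<exists>\<pi>0. joint_pmf n (m - 1) \<pi>0 \<and>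
        (\<forall>t. \<forall>i\<in>{1..n}. state_marginal n (m - 1) (memory_dist n p \<pi>0 t) i = x i))"

text \<open>
  Second largest modulus of a U-eigenvalue when 1 is the simple dominant one. If there is no other
  U-eigenvalue (which then forces \<open>n = 1\<close>), the value is 0.
\<close>

definition second_U_modulus ::
  "nat \<Rightarrow> nat \<Rightarrow> (nat list \<Rightarrow> nat list \<Rightarrow> complex) \<Rightarrow> real" where
  "second_U_modulus n N A = Max (insert 0 {cmod \<mu> | \<mu>. U_eigenvalue n N A \<mu> \<and> \<mu> \<noteq> 1})"

definition tensor_dist :: "nat \<Rightarrow> nat \<Rightarrow> (nat list \<Rightarrow> real) \<Rightarrow> (nat list \<Rightarrow> real) \<Rightarrow> real" where
  "tensor_dist n N X Y = (\<Sum>is\<in>midx n N. \<bar>X is - Y is\<bar>)"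

text \<open>
  A property is generic if it holds for all joint distributions outside a hyperplane that does not
  contain the whole probability simplex.
\<close>

definition generic_joint_pmf :: "nat \<Rightarrow> nat \<Rightarrow> ((nat list \<Rightarrow> real) \<Rightarrow> bool) \<Rightarrow> bool" where
  "generic_joint_pmf n N Q \<longleftrightarrow>
     (\<exists>c. (\<exists>\<pi>. joint_pmf n N \<pi> \<and> (\<Sum>is\<in>midx n N. c is * \<pi> is) \<noteq> 0) \<and>
        (\<forall>\<pi>. joint_pmf n N \<pi> \<and> (\<Sum>is\<in>midx n N. c is * \<pi> is) \<noteq> 0 \<longrightarrow> Q \<pi>))"

end

theory Submission
  imports Defs "Jordan_Normal_Form.Spectral_Radius"
begin

text \<open>
  Some power of the unfolding \<open>B\<close> has only positive entries, so it contracts the \<open>l\<^sup>1\<close> norm on the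
  vectors whose entries sum to 0, while \<open>B\<close> itself preserves the sum of entries. Hence every
  eigenvector on that hyperplane has an eigenvalue of modulus less than 1, every eigenvector for an
  eigenvalue other than 1 lies on it, and the fixed vectors form a line; replacing the entries of a
  fixed vector by their moduli shows that the line is spanned by a positive vector \<open>w\<close>. The difference
  of two joint distributions lies on the hyperplane, where \<open>B\<close> acts like \<open>B - w 1\<^sup>T\<close>. The spectral
  radius of this matrix is the second largest modulus of an eigenvalue of \<open>B\<close>, which gives the upper
  bound on the rate. A left eigenvector for a subdominant eigenvalue gives the lower bound, unless it
  annihilates the initial distribution.
\<close>

unbundle no vec_syntax

section \<open>Sums and \<open>l\<^sup>1\<close> norms of vectors\<close>

text \<open>Let \<rho> be the second largest modulus. A bound by a constant times
  \<open>\<rho> ^ t\<close> can fail, since nontrivial Jordan blocks of subdominant eigenvalues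
  contribute polynomial factors. The upper bound is therefore proved for every
  \<open>r > \<rho>\<close>, and the rate is measured by t-th roots, which do not see such factors.
  For positive \<rho> no lower bound holds for all starts, because the stationary start has error 0;
  so the rate is a bound for all starts and a limit only for generic ones. Simplicity of the
  eigenvalue 1 is algebraic, a matter of the characteristic polynomial, and a one-dimensional space
  of fixed vectors does not settle it; preservation of totals closes this gap. Vectors are complex
  because subdominant eigenvalues need not be real.\<close>

abbreviation cmat :: "real mat \<Rightarrow> complex mat" where
  "cmat \<equiv> map_mat complex_of_real"

definition vec_total :: "'a::comm_monoid_add Matrix.vec \<Rightarrow> 'a" where
  "vec_total v = (\<Sum>i<dim_vec v. v $ i)"

definition l1_norm :: "'a::real_normed_vector Matrix.vec \<Rightarrow> real" where
  "l1_norm v = (\<Sum>i<dim_vec v. norm (v $ i))"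

lemma l1_norm_nonneg: "0 \<le> l1_norm v"
  by (simp add: l1_norm_def sum_nonneg)

lemma l1_norm_eq_0_iff:
  assumes "v \<in> carrier_vec N"
  shows "l1_norm v = 0 \<longleftrightarrow> v = 0\<^sub>v N"
  using assms by (auto simp: l1_norm_def sum_nonneg_eq_0_iff)

lemma l1_norm_smult: "l1_norm (c \<cdot>\<^sub>v v) = norm c * l1_norm (v :: complex Matrix.vec)"
  by (simp add: l1_norm_def sum_distrib_left norm_mult)

lemma vec_total_smult: "vec_total (c \<cdot>\<^sub>v v) = c * vec_total (v :: 'a::comm_ring_1 Matrix.vec)"
  by (simp add: vec_total_def sum_distrib_left)

lemma vec_total_minus:
  "v \<in> carrier_vec N \<Longrightarrow> w \<in> carrier_vec N \<Longrightarrow> vec_total (v - w) = vec_total v - vec_total (w :: 'a::comm_ring_1 Matrix.vec)"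
  by (simp add: vec_total_def sum_subtractf)

lemma vec_total_add:
  "v \<in> carrier_vec N \<Longrightarrow> w \<in> carrier_vec N \<Longrightarrow> vec_total (v + w) = vec_total v + vec_total (w :: 'a::comm_ring_1 Matrix.vec)"
  by (simp add: vec_total_def sum.distrib)

lemma mult_mat_vec_entry:
  assumes "M \<in> carrier_mat N N" "v \<in> carrier_vec N" "i < N"
  shows "(M *\<^sub>v v) $ i = (\<Sum>j<N. M $$ (i, j) * v $ j)"
  using assms by (auto simp: scalar_prod_def atLeast0LessThan intro!: sum.cong)

lemma mult_mat_entry:
  assumes "M \<in> carrier_mat N N" "M' \<in> carrier_mat N N" "i < N" "j < N"
  shows "(M * M') $$ (i, j) = (\<Sum>l<N. M $$ (i, l) * M' $$ (l, j))"
  using assms by (auto simp: scalar_prod_def atLeast0LessThan intro!: sum.cong)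

lemma vec_total_mult_mat_vec:
  fixes M :: "'a::comm_ring_1 mat"
  assumes "M \<in> carrier_mat N N" "v \<in> carrier_vec N"
    and "\<And>j. j < N \<Longrightarrow> (\<Sum>i<N. M $$ (i, j)) = 1"
  shows "vec_total (M *\<^sub>v v) = vec_total v"
proof -
  have "vec_total (M *\<^sub>v v) = (\<Sum>i<N. \<Sum>j<N. M $$ (i, j) * v $ j)"
    using assms(1,2) mult_mat_vec_entry[OF assms(1,2)] by (simp add: vec_total_def)
  also have "\<dots> = (\<Sum>j<N. (\<Sum>i<N. M $$ (i, j)) * v $ j)"
    by (subst sum.swap) (simp add: sum_distrib_right)
  also have "\<dots> = vec_total v"
    using assms by (simp add: vec_total_def)
  finally show ?thesis .
qed

text \<open>Powers multiply the new factor on the right, so the first form is associativity. The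
  second form, with the new factor applied last, matches an iterated update and needs an induction
  over all \<open>v\<close>.\<close>

lemma pow_mat_Suc_vec:
  assumes "M \<in> carrier_mat N N" "v \<in> carrier_vec N"
  shows "M ^\<^sub>m Suc t *\<^sub>v v = M ^\<^sub>m t *\<^sub>v (M *\<^sub>v v)"
    and "M ^\<^sub>m Suc t *\<^sub>v v = M *\<^sub>v (M ^\<^sub>m t *\<^sub>v v)"
proof -
  have 1: "M ^\<^sub>m Suc t *\<^sub>v v = M ^\<^sub>m t *\<^sub>v (M *\<^sub>v v)" if "v \<in> carrier_vec N" for t v
    using assms(1) that assoc_mult_mat_vec[OF pow_carrier_mat[OF assms(1), of t] assms(1) that] by simp
  show "M ^\<^sub>m Suc t *\<^sub>v v = M ^\<^sub>m t *\<^sub>v (M *\<^sub>v v)"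
    using 1 assms(2) .
  show "M ^\<^sub>m Suc t *\<^sub>v v = M *\<^sub>v (M ^\<^sub>m t *\<^sub>v v)"
    using assms(2)
  proof (induction t arbitrary: v)
    case 0
    then show ?case using assms(1) by simp
  next
    case (Suc t)
    have "M ^\<^sub>m Suc (Suc t) *\<^sub>v v = M ^\<^sub>m Suc t *\<^sub>v (M *\<^sub>v v)"
      by (rule 1[OF Suc.prems])
    also have "\<dots> = M *\<^sub>v (M ^\<^sub>m t *\<^sub>v (M *\<^sub>v v))"
      by (rule Suc.IH) (use Suc.prems assms(1) in simp)
    also have "M ^\<^sub>m t *\<^sub>v (M *\<^sub>v v) = M ^\<^sub>m Suc t *\<^sub>v v"
      by (rule 1[OF Suc.prems, symmetric])
    finally show ?case .
  qed
qed

section \<open>Column-stochastic matrices with a positive power\<close>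

text \<open>The exponent \<open>k\<close> witnesses primitivity. \<open>dim_pos\<close> gives the
  set of entries a minimum and makes the all-ones vector nonzero.\<close>

locale primitive_stochastic =
  fixes N :: nat and B :: "real mat" and k :: nat
  assumes carrier: "B \<in> carrier_mat N N"
    and dim_pos: "0 < N"
    and nonneg: "\<And>i j. i < N \<Longrightarrow> j < N \<Longrightarrow> 0 \<le> B $$ (i, j)"
    and column_sum: "\<And>j. j < N \<Longrightarrow> (\<Sum>i<N. B $$ (i, j)) = 1"
    and power_pos: "\<And>i j. i < N \<Longrightarrow> j < N \<Longrightarrow> 0 < (B ^\<^sub>m k) $$ (i, j)"
begin

lemma cmat_carrier: "cmat B \<in> carrier_mat N N"
  using carrier by simp

lemma cmat_entry: "i < N \<Longrightarrow> j < N \<Longrightarrow> cmat B $$ (i, j) = of_real (B $$ (i, j))"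
  using carrier by simp

lemma cmat_column_sum: "j < N \<Longrightarrow> (\<Sum>i<N. cmat B $$ (i, j)) = 1"
  by (simp add: cmat_entry column_sum flip: of_real_sum)

lemma cmat_power: "cmat B ^\<^sub>m t = cmat (B ^\<^sub>m t)"
  by (rule of_real_hom.mat_hom_pow[OF carrier, symmetric])

lemma power_column_sum: "j < N \<Longrightarrow> (\<Sum>i<N. (B ^\<^sub>m t) $$ (i, j)) = 1"
proof (induction t arbitrary: j)
  case 0
  then show ?case using carrier by (simp add: if_distrib sum.delta cong: if_cong)
next
  case (Suc t)
  have "(\<Sum>i<N. (B ^\<^sub>m Suc t) $$ (i, j)) = (\<Sum>i<N. \<Sum>l<N. (B ^\<^sub>m t) $$ (i, l) * B $$ (l, j))"
    using Suc.prems mult_mat_entry[OF pow_carrier_mat[OF carrier, of t] carrier] by simp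
  also have "\<dots> = (\<Sum>l<N. (\<Sum>i<N. (B ^\<^sub>m t) $$ (i, l)) * B $$ (l, j))"
    by (subst sum.swap) (simp add: sum_distrib_right)
  also have "\<dots> = (\<Sum>l<N. B $$ (l, j))"
  proof (rule sum.cong)
    fix l assume "l \<in> {..<N}"
    then show "(\<Sum>i<N. (B ^\<^sub>m t) $$ (i, l)) * B $$ (l, j) = B $$ (l, j)"
      using Suc.IH by simp
  qed simp
  finally show ?case using column_sum Suc.prems by simp
qed


lemma vec_total_cmat: "v \<in> carrier_vec N \<Longrightarrow> vec_total (cmat B *\<^sub>v v) = vec_total v"
  by (rule vec_total_mult_mat_vec[OF cmat_carrier]) (simp_all add: cmat_column_sum)

lemma vec_total_cmat_power:
  "v \<in> carrier_vec N \<Longrightarrow> vec_total (cmat B ^\<^sub>m t *\<^sub>v v) = vec_total v"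
proof (induction t)
  case (Suc t)
  then show ?case
    unfolding pow_mat_Suc_vec(2)[OF cmat_carrier Suc.prems]
    using vec_total_cmat[of "cmat B ^\<^sub>m t *\<^sub>v v"] mult_mat_vec_carrier[OF pow_carrier_mat[OF cmat_carrier, of t]]
    by simp
qed (use carrier in simp)

lemma cmat_power_entry:
  "v \<in> carrier_vec N \<Longrightarrow> i < N \<Longrightarrow>
    (cmat B ^\<^sub>m t *\<^sub>v v) $ i = (\<Sum>j<N. of_real ((B ^\<^sub>m t) $$ (i, j)) * v $ j)"
  unfolding cmat_power
  using mult_mat_vec_entry[of "cmat (B ^\<^sub>m t)" N v i] carrier by simp

text \<open>
  Subtracting the smallest entry \<open>d\<close> from every entry of \<open>B\<^sup>k\<close> does not change its action on vectors
  of total 0, and the columns of the difference sum to \<open>1 - N * d\<close>.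
\<close>

lemma ex_contraction:
  "\<exists>q<1. \<forall>v\<in>carrier_vec N. vec_total v = 0 \<longrightarrow> l1_norm (cmat B ^\<^sub>m k *\<^sub>v v) \<le> q * l1_norm v"
proof -
  define d where "d = Min ((\<lambda>(i, j). (B ^\<^sub>m k) $$ (i, j)) ` ({..<N} \<times> {..<N}))"
  have "d \<in> (\<lambda>(i, j). (B ^\<^sub>m k) $$ (i, j)) ` ({..<N} \<times> {..<N})"
    unfolding d_def using dim_pos by (intro Min_in) auto
  then have d_pos: "d > 0" using power_pos by auto
  have d_le: "d \<le> (B ^\<^sub>m k) $$ (i, j)" if "i < N" "j < N" for i j
    unfolding d_def using that by (intro Min_le) auto
  have "l1_norm (cmat B ^\<^sub>m k *\<^sub>v v) \<le> (1 - N * d) * l1_norm v"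
    if v: "v \<in> carrier_vec N" "vec_total v = 0" for v
  proof -
    have le: "cmod ((cmat B ^\<^sub>m k *\<^sub>v v) $ i) \<le> (\<Sum>j<N. ((B ^\<^sub>m k) $$ (i, j) - d) * cmod (v $ j))"
      if i: "i < N" for i
    proof -
      have "(\<Sum>j<N. v $ j) = 0" using v by (simp add: vec_total_def)
      then have "(cmat B ^\<^sub>m k *\<^sub>v v) $ i = (\<Sum>j<N. of_real ((B ^\<^sub>m k) $$ (i, j)) * v $ j) - of_real d * (\<Sum>j<N. v $ j)"
        using cmat_power_entry[OF v(1) i] by simp
      also have "\<dots> = (\<Sum>j<N. of_real ((B ^\<^sub>m k) $$ (i, j) - d) * v $ j)"
        by (simp add: sum_distrib_left sum_subtractf algebra_simps)
      finally have "cmod ((cmat B ^\<^sub>m k *\<^sub>v v) $ i) \<le> (\<Sum>j<N. cmod (of_real ((B ^\<^sub>m k) $$ (i, j) - d) * v $ j))"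
        by (simp only: sum_norm_le order_refl norm_sum)
      also have "\<dots> = (\<Sum>j<N. ((B ^\<^sub>m k) $$ (i, j) - d) * cmod (v $ j))"
        using d_le[OF i] by (intro sum.cong) (auto simp: norm_mult simp flip: of_real_diff)
      finally show ?thesis .
    qed
    have "l1_norm (cmat B ^\<^sub>m k *\<^sub>v v) = (\<Sum>i<N. cmod ((cmat B ^\<^sub>m k *\<^sub>v v) $ i))"
      using carrier by (simp add: l1_norm_def)
    also have "\<dots> \<le> (\<Sum>i<N. \<Sum>j<N. ((B ^\<^sub>m k) $$ (i, j) - d) * cmod (v $ j))"
      using le by (intro sum_mono) auto
    also have "\<dots> = (\<Sum>j<N. (\<Sum>i<N. (B ^\<^sub>m k) $$ (i, j) - d) * cmod (v $ j))"
      by (subst sum.swap) (simp add: sum_distrib_right)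
    also have "\<dots> = (\<Sum>j<N. (1 - N * d) * cmod (v $ j))"
      by (intro sum.cong) (auto simp: sum_subtractf power_column_sum)
    also have "\<dots> = (1 - N * d) * l1_norm v"
      using v by (simp add: l1_norm_def sum_distrib_left)
    finally show ?thesis .
  qed
  moreover have "1 - N * d < 1" using d_pos dim_pos by simp
  ultimately show ?thesis by blast
qed

section \<open>Eigenvectors, totals and the fixed line\<close>

text \<open>The \<open>k\<close>-th power scales the norm of \<open>v\<close> by exactly
  \<open>cmod \<mu> ^ k\<close>, yet by at most some \<open>q < 1\<close>. The case \<mu> = 1 is
  included; it shows that a fixed vector is determined by its total.\<close>

lemma eigenvector_total_0:
  assumes v: "v \<in> carrier_vec N" "v \<noteq> 0\<^sub>v N" "cmat B *\<^sub>v v = \<mu> \<cdot>\<^sub>v v" and "vec_total v = 0"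
  shows "cmod \<mu> < 1"
proof -
  obtain q where q: "q < 1"
    "l1_norm (cmat B ^\<^sub>m k *\<^sub>v v) \<le> q * l1_norm v"
    using ex_contraction assms by blast
  have "eigenvector (cmat B) v \<mu>"
    using v carrier by (simp add: eigenvector_def)
  then have "cmat B ^\<^sub>m k *\<^sub>v v = \<mu> ^ k \<cdot>\<^sub>v v"
    by (rule eigenvector_pow[OF cmat_carrier])
  then have "cmod \<mu> ^ k * l1_norm v \<le> q * l1_norm v"
    using q by (simp add: l1_norm_smult norm_power)
  moreover have "l1_norm v > 0"
    using l1_norm_nonneg[of v] l1_norm_eq_0_iff[OF v(1)] v(2) by linarith
  ultimately have "cmod \<mu> ^ k < 1" using q by auto
  then show ?thesis
    by (meson not_less one_le_power)
qed

lemma eigenvector_total: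
  assumes "v \<in> carrier_vec N" "cmat B *\<^sub>v v = \<mu> \<cdot>\<^sub>v v" "\<mu> \<noteq> 1"
  shows "vec_total v = 0"
proof -
  have "vec_total v = \<mu> * vec_total v"
    using vec_total_cmat[OF assms(1)] assms(2) by (simp add: vec_total_smult)
  then show ?thesis using assms(3) by simp
qed

lemma eigenvalue_cmod_less_1:
  assumes "eigenvalue (cmat B) \<mu>" "\<mu> \<noteq> 1"
  shows "cmod \<mu> < 1"
proof -
  obtain v where v: "v \<in> carrier_vec N" "v \<noteq> 0\<^sub>v N" "cmat B *\<^sub>v v = \<mu> \<cdot>\<^sub>v v"
    using assms carrier by (auto simp: eigenvalue_def eigenvector_def)
  show ?thesis
    using eigenvector_total_0[OF v eigenvector_total[OF v(1,3) assms(2)]] .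
qed

lemma fixed_total_0:
  assumes "v \<in> carrier_vec N" "cmat B *\<^sub>v v = v" "vec_total v = 0"
  shows "v = 0\<^sub>v N"
  using eigenvector_total_0[of v 1] assms by auto

text \<open>Removing from \<open>v\<close> its total in the direction of \<open>w\<close> leaves a
  fixed vector of total 0, which must vanish.\<close>

lemma fixed_eq:
  assumes v: "v \<in> carrier_vec N" "cmat B *\<^sub>v v = v"
    and w: "w \<in> carrier_vec N" "cmat B *\<^sub>v w = w" "vec_total w = 1"
  shows "v = vec_total v \<cdot>\<^sub>v w"
proof -
  let ?u = "v - vec_total v \<cdot>\<^sub>v w"
  have "cmat B *\<^sub>v ?u = cmat B *\<^sub>v v - cmat B *\<^sub>v (vec_total v \<cdot>\<^sub>v w)"
    by (rule mult_minus_distrib_mat_vec[OF cmat_carrier]) (use v w in auto)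
  also have "\<dots> = ?u"
    using v w by (simp add: mult_mat_vec[OF cmat_carrier])
  finally have "?u = 0\<^sub>v N"
    using v w by (intro fixed_total_0) (auto simp: vec_total_minus[of _ N] vec_total_smult)
  then have "?u $ i = 0" if "i < N" for i using that by simp
  then show ?thesis using v w by (intro eq_vecI) auto
qed

text \<open>Unit column sums say that the all-ones vector is fixed by the transpose, and a matrix
  and its transpose have the same characteristic polynomial.\<close>

lemma eigenvalue_1: "eigenvalue (cmat B) 1"
proof -
  let ?e = "Matrix.vec N (\<lambda>_. 1) :: complex Matrix.vec"
  have T: "transpose_mat (cmat B) \<in> carrier_mat N N" using carrier by simp
  have "transpose_mat (cmat B) *\<^sub>v ?e = 1 \<cdot>\<^sub>v ?e"
  proof (rule eq_vecI)
    fix i assume "i < dim_vec (1 \<cdot>\<^sub>v ?e)"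
    then have i: "i < N" by simp
    have "(transpose_mat (cmat B) *\<^sub>v ?e) $ i = (\<Sum>j<N. cmat B $$ (j, i))"
      using mult_mat_vec_entry[OF T, of ?e i] i carrier by simp
    then show "(transpose_mat (cmat B) *\<^sub>v ?e) $ i = (1 \<cdot>\<^sub>v ?e) $ i"
      using cmat_column_sum[OF i] i by simp
  qed (use carrier in simp)
  moreover have "?e \<noteq> 0\<^sub>v N"
    using dim_pos by (metis index_vec index_zero_vec(1) zero_neq_one)
  ultimately have "eigenvalue (transpose_mat (cmat B)) 1"
    using carrier unfolding eigenvalue_def eigenvector_def by (intro exI[of _ ?e]) simp
  then show ?thesis
    using eigenvalue_root_char_poly[OF T] eigenvalue_root_char_poly[OF cmat_carrier]
      char_poly_transpose_mat[OF cmat_carrier] by simp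
qed

text \<open>For a fixed vector \<open>v\<close>, the triangle inequality makes its vector of moduli
  \<open>u\<close> at most its image under \<open>B\<close>, entry by entry. Both have the same
  total, so there is no slack and \<open>u\<close> is fixed too.\<close>

lemma ex_fixed_vec:
  "\<exists>w. w \<in> carrier_vec N \<and> cmat B *\<^sub>v map_vec complex_of_real w = map_vec complex_of_real w \<and>
     vec_total w = 1 \<and> (\<forall>i<N. 0 < w $ i)"
proof -
  obtain v where v: "v \<in> carrier_vec N" "v \<noteq> 0\<^sub>v N" "cmat B *\<^sub>v v = v"
    using eigenvalue_1 carrier by (auto simp: eigenvalue_def eigenvector_def)
  define u where "u = Matrix.vec N (\<lambda>i. cmod (v $ i))"
  let ?u = "map_vec complex_of_real u"
  have u: "u \<in> carrier_vec N" "?u \<in> carrier_vec N" by (auto simp: u_def)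
  have Bv: "v $ i = (\<Sum>j<N. of_real (B $$ (i, j)) * v $ j)" if "i < N" for i
    using mult_mat_vec_entry[OF cmat_carrier v(1) that] that v carrier by simp
  have le: "u $ i \<le> (\<Sum>j<N. B $$ (i, j) * u $ j)" if i: "i < N" for i
  proof -
    have "u $ i = cmod (\<Sum>j<N. of_real (B $$ (i, j)) * v $ j)"
      using Bv[OF i] i by (simp add: u_def)
    also have "\<dots> \<le> (\<Sum>j<N. cmod (of_real (B $$ (i, j)) * v $ j))"
      by (rule norm_sum)
    also have "\<dots> = (\<Sum>j<N. B $$ (i, j) * u $ j)"
      using nonneg[OF i] by (intro sum.cong) (auto simp: norm_mult u_def)
    finally show ?thesis .
  qed
  have "(\<Sum>i<N. \<Sum>j<N. B $$ (i, j) * u $ j) = (\<Sum>j<N. (\<Sum>i<N. B $$ (i, j)) * u $ j)"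
    by (subst sum.swap) (simp add: sum_distrib_right)
  then have "(\<Sum>i<N. (\<Sum>j<N. B $$ (i, j) * u $ j) - u $ i) = 0"
    by (simp add: column_sum sum_subtractf)
  then have eq: "(\<Sum>j<N. B $$ (i, j) * u $ j) = u $ i" if "i < N" for i
    using le that by (subst (asm) sum_nonneg_eq_0_iff) auto
  have fix_u: "cmat B *\<^sub>v ?u = ?u"
  proof (rule eq_vecI)
    fix i assume "i < dim_vec ?u"
    then have i: "i < N" using u by simp
    have "(cmat B *\<^sub>v ?u) $ i = (\<Sum>j<N. of_real (B $$ (i, j) * u $ j))"
      using mult_mat_vec_entry[OF cmat_carrier u(2) i] i u carrier by simp
    also have "\<dots> = of_real (u $ i)" using eq[OF i] by (simp only: flip: of_real_sum)
    finally show "(cmat B *\<^sub>v ?u) $ i = ?u $ i" using i u by simp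
  qed (use u carrier in simp)
  obtain l where l: "l < N" "v $ l \<noteq> 0"
    using v by (metis carrier_vecD eq_vecI index_zero_vec)
  have u_nonneg: "0 \<le> u $ i" if "i < N" for i using that by (simp add: u_def)
  have u_l: "0 < u $ l" using l by (simp add: u_def)
  have "(\<Sum>i\<in>{l}. u $ i) \<le> (\<Sum>i<N. u $ i)"
    using l u_nonneg by (intro sum_mono2) auto
  then have tot: "0 < vec_total u" using u u_l by (simp add: vec_total_def)
  \<comment> \<open>\<open>u\<close> is also fixed by the \<open>k\<close>-th power, whose positive
    entries spread the single positive entry \<open>u $ l\<close> to every position.\<close>
  have u_pos: "0 < u $ i" if i: "i < N" for i
  proof -
    have "cmat B ^\<^sub>m k *\<^sub>v ?u = 1 ^ k \<cdot>\<^sub>v ?u"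
      using u fix_u u_l l carrier by (intro eigenvector_pow[OF cmat_carrier]) (auto simp: eigenvector_def)
    then have "of_real (u $ i) = (cmat B ^\<^sub>m k *\<^sub>v ?u) $ i"
      using i u by simp
    also have "\<dots> = of_real (\<Sum>j<N. (B ^\<^sub>m k) $$ (i, j) * u $ j)"
      using cmat_power_entry[OF u(2) i] u by simp
    finally have "u $ i = (\<Sum>j<N. (B ^\<^sub>m k) $$ (i, j) * u $ j)"
      by (simp only: of_real_eq_iff)
    moreover have "(B ^\<^sub>m k) $$ (i, j) * u $ j \<ge> 0" if "j < N" for j
      using power_pos[OF i that] u_nonneg[OF that] by simp
    moreover have "(B ^\<^sub>m k) $$ (i, l) * u $ l > 0"
      using power_pos[OF i l(1)] u_l by simp
    ultimately show ?thesis
      using l(1) by (metis (no_types, lifting) finite_lessThan lessThan_iff sum_pos2)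
  qed
  define w where "w = (1 / vec_total u) \<cdot>\<^sub>v u"
  have "map_vec complex_of_real w = of_real (1 / vec_total u) \<cdot>\<^sub>v ?u"
    by (rule eq_vecI) (auto simp: w_def)
  then have "cmat B *\<^sub>v map_vec complex_of_real w = map_vec complex_of_real w"
    using mult_mat_vec[OF cmat_carrier u(2)] fix_u by simp
  moreover have "vec_total w = 1" using tot by (simp add: w_def vec_total_smult)
  moreover have "w \<in> carrier_vec N" "\<forall>i<N. 0 < w $ i"
    using u u_pos tot by (auto simp: w_def)
  ultimately show ?thesis by blast
qed

text \<open>
  If 1 occurred twice on the diagonal of a triangular form of \<open>B\<close>, then the span of its first two
  basis vectors would consist of fixed vectors, because \<open>vec_total\<close> is preserved.
\<close>

lemma order_1: "Polynomial.order 1 (char_poly (cmat B)) = 1"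
proof -
  let ?A = "cmat B"
  obtain as where as: "char_poly ?A = (\<Prod>a\<leftarrow>as. [:- a, 1:])"
    using char_poly_factorized[OF cmat_carrier] by blast
  have "1 \<in> set as"
    using eigenvalue_1 eigenvalue_root_char_poly[OF cmat_carrier, of 1]
    by (auto simp: as poly_prod_list prod_list_zero_iff)
  define bs where "bs = remove1 1 as"
  have bs: "char_poly ?A = [:- 1, 1:] * (\<Prod>a\<leftarrow>bs. [:- a, 1:])"
    unfolding as bs_def using prod_list_map_remove1[OF \<open>1 \<in> set as\<close>, of "\<lambda>a. [:- a, 1:]"] .
  have ne: "char_poly ?A \<noteq> 0"
    using degree_monic_char_poly[OF cmat_carrier] by auto
  have "1 \<notin> set bs"
  proof
    assume "1 \<in> set bs"
    define cs where "cs = remove1 1 bs"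
    have cs: "char_poly ?A = (\<Prod>a\<leftarrow>1 # 1 # cs. [:- a, 1:])"
      unfolding bs prod_list_map_remove1[OF \<open>1 \<in> set bs\<close>, of "\<lambda>a. [:- a, 1:]"]
      by (simp only: cs_def list.map prod_list.Cons)
    \<comment> \<open>The diagonal of the Schur form follows the order of the given list, so the two
      1s placed in front occupy its first two positions.\<close>
    obtain T P Q where "schur_decomposition ?A (1 # 1 # cs) = (T, P, Q)"
      by (rule prod_cases3)
    from schur_decomposition[OF cmat_carrier cs this]
    have sim: "similar_mat_wit ?A T P Q" and ut: "upper_triangular T"
      and diag: "diag_mat T = 1 # 1 # cs" by auto
    note wit = similar_mat_witD2[OF cmat_carrier sim]
    have N2: "2 \<le> N"
      using arg_cong[OF diag, of length] wit(5) by (simp add: diag_mat_def)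
    have T00: "T $$ (0, 0) = 1" and T11: "T $$ (1, 1) = 1"
      using arg_cong[OF diag, of "\<lambda>xs. xs ! 0"] arg_cong[OF diag, of "\<lambda>xs. xs ! 1"] wit(5) N2
      by (auto simp: diag_mat_def)
    let ?x = "col P 0" and ?y = "col P 1"
    have AP: "?A * P = P * T"
    proof -
      have "?A * P = P * T * (Q * P)"
        using wit(3) assoc_mult_mat[OF mult_carrier_mat[OF wit(6,5)] wit(7,6)] by simp
      then show ?thesis using wit by simp
    qed
    have c: "?x \<in> carrier_vec N" "?y \<in> carrier_vec N"
      using wit(6) N2 by auto
    have Acol: "(?A *\<^sub>v col P j) $ i = (\<Sum>l<N. P $$ (i, l) * T $$ (l, j))" if "i < N" "j < N" for i j
    proof -
      have "(?A *\<^sub>v col P j) $ i = (?A * P) $$ (i, j)"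
        using that carrier wit(6) by (simp add: mult_mat_vec_def)
      then show ?thesis using AP mult_mat_entry[OF wit(6,5) that] by simp
    qed
    have lower: "T $$ (l, j) = 0" if "j < l" "l < N" for l j
      using ut that wit(5) by (auto simp: upper_triangular_def)
    have x: "?A *\<^sub>v ?x = ?x"
    proof (rule eq_vecI)
      fix i assume "i < dim_vec ?x"
      then have i: "i < N" using wit(6) by simp
      have "(\<Sum>l<N. P $$ (i, l) * T $$ (l, 0)) = (\<Sum>l\<in>{0}. P $$ (i, l) * T $$ (l, 0))"
        using lower N2 by (intro sum.mono_neutral_right) auto
      then show "(?A *\<^sub>v ?x) $ i = ?x $ i"
        using Acol[OF i] N2 i wit(6) T00 by simp
    qed (use carrier wit(6) in simp)
    have y: "?A *\<^sub>v ?y = ?y + T $$ (0, 1) \<cdot>\<^sub>v ?x"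
    proof (rule eq_vecI)
      fix i assume "i < dim_vec (?y + T $$ (0, 1) \<cdot>\<^sub>v ?x)"
      then have i: "i < N" using wit(6) by simp
      have "(\<Sum>l<N. P $$ (i, l) * T $$ (l, 1)) = (\<Sum>l\<in>{0, 1}. P $$ (i, l) * T $$ (l, 1))"
        using lower N2 by (intro sum.mono_neutral_right) auto
      then show "(?A *\<^sub>v ?y) $ i = (?y + T $$ (0, 1) \<cdot>\<^sub>v ?x) $ i"
        using Acol[OF i, of 1] N2 i wit(6) T11 by simp
    qed (use carrier wit(6) in simp)
    \<comment> \<open>\<open>Q\<close> inverts \<open>P\<close>; this is used both to see that
      column 0 of \<open>P\<close> is nonzero and that columns 0 and 1 are not proportional.\<close>
    have QPcol: "(\<Sum>l<N. Q $$ (i, l) * col P j $ l) = (if i = j then 1 else 0)" if "i < N" "j < N" for i j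
      using mult_mat_entry[OF wit(7,6) that] wit(2,6) that by simp
    have tx: "vec_total ?x \<noteq> 0"
    proof
      assume "vec_total ?x = 0"
      then have "?x = 0\<^sub>v N" using fixed_total_0 c x by blast
      then show False using QPcol[of 0 0] N2 by simp
    qed
    \<comment> \<open>Comparing totals in \<open>y\<close> forces the superdiagonal entry
      \<open>T $$ (0, 1)\<close> to vanish, so \<open>?y\<close> is fixed as well.\<close>
    have "vec_total (?y + T $$ (0, 1) \<cdot>\<^sub>v ?x) = vec_total ?y"
      using vec_total_cmat[OF c(2)] unfolding y .
    then have "T $$ (0, 1) * vec_total ?x = 0"
      using vec_total_add[OF c(2) smult_carrier_vec[THEN iffD2, OF c(1)]] by (simp only: vec_total_smult add_cancel_left_right)
    then have "T $$ (0, 1) = 0" using tx by (simp only: mult_eq_0_iff) simp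
    then have "?A *\<^sub>v ?y = ?y + 0 \<cdot>\<^sub>v ?x" using y by simp
    also have "\<dots> = ?y" using c wit(6) by (intro eq_vecI) auto
    finally have y': "?A *\<^sub>v ?y = ?y" .
    let ?w = "(1 / vec_total ?x) \<cdot>\<^sub>v ?x"
    have "?y = vec_total ?y \<cdot>\<^sub>v ?w"
    proof (rule fixed_eq[OF c(2) y'])
      show "?A *\<^sub>v ?w = ?w" using mult_mat_vec[OF cmat_carrier c(1)] x by simp
    qed (use c tx in \<open>auto simp: vec_total_smult\<close>)
    then have "?y $ l = (vec_total ?y \<cdot>\<^sub>v ?w) $ l" for l
      by (rule arg_cong)
    then have "?y $ l = vec_total ?y / vec_total ?x * ?x $ l" if "l < N" for l
      using that wit(6) by simp
    \<comment> \<open>Row 1 of \<open>Q\<close> takes the value 1 on \<open>?y\<close> and 0 on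
      \<open>?x\<close>, which rules out that \<open>?y\<close> is a multiple of
      \<open>?x\<close>.\<close>
    then have "(\<Sum>l<N. Q $$ (1, l) * ?y $ l) = vec_total ?y / vec_total ?x * (\<Sum>l<N. Q $$ (1, l) * ?x $ l)"
      by (simp add: sum_distrib_left mult_ac)
    then show False using QPcol[of 1 1] QPcol[of 1 0] N2 by simp
  qed
  then have "poly (\<Prod>a\<leftarrow>bs. [:- a, 1:]) 1 \<noteq> (0 :: complex)"
    by (auto simp: poly_prod_list prod_list_zero_iff)
  then have "Polynomial.order 1 (\<Prod>a\<leftarrow>bs. [:- a, 1:]) = 0"
    by (rule order_0I)
  then show ?thesis
    unfolding bs using ne[unfolded bs] order_power_n_n[of 1 1] by (subst order_mult) auto
qed

end

section \<open>Rate of convergence\<close>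

context primitive_stochastic
begin

text \<open>The matrix counterpart of \<open>second_U_modulus\<close>; the inserted 0 keeps
  \<open>Max\<close> meaningful when 1 is the only eigenvalue.\<close>

definition subdominant_modulus :: real where
  "subdominant_modulus = Max (insert 0 {cmod \<mu> | \<mu>. eigenvalue (cmat B) \<mu> \<and> \<mu> \<noteq> 1})"

lemma finite_subdominant: "finite {cmod \<mu> | \<mu>. eigenvalue (cmat B) \<mu> \<and> \<mu> \<noteq> 1}"
proof (rule finite_subset)
  show "{cmod \<mu> | \<mu>. eigenvalue (cmat B) \<mu> \<and> \<mu> \<noteq> 1} \<subseteq> cmod ` spectrum (cmat B)"
    by (auto simp: spectrum_def)
  show "finite (cmod ` spectrum (cmat B))"
    using card_finite_spectrum(1)[OF cmat_carrier] by (rule finite_imageI)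
qed

lemma subdominant_modulus_nonneg: "0 \<le> subdominant_modulus"
  unfolding subdominant_modulus_def by (rule Max_ge) (simp_all add: finite_subdominant)

lemma cmod_le_subdominant_modulus:
  "eigenvalue (cmat B) \<mu> \<Longrightarrow> \<mu> \<noteq> 1 \<Longrightarrow> cmod \<mu> \<le> subdominant_modulus"
  unfolding subdominant_modulus_def by (rule Max_ge) (auto simp: finite_subdominant)

lemma subdominant_modulus_cases:
  obtains "subdominant_modulus = 0"
  | \<mu> where "eigenvalue (cmat B) \<mu>" "\<mu> \<noteq> 1" "cmod \<mu> = subdominant_modulus"
proof -
  have "subdominant_modulus \<in> insert 0 {cmod \<mu> | \<mu>. eigenvalue (cmat B) \<mu> \<and> \<mu> \<noteq> 1}"
    unfolding subdominant_modulus_def by (rule Max_in) (simp_all add: finite_subdominant)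
  then show ?thesis using that by auto
qed

lemma subdominant_modulus_less_1: "subdominant_modulus < 1"
  by (cases rule: subdominant_modulus_cases) (auto dest: eigenvalue_cmod_less_1)

text \<open>
  The deflated matrix \<open>B - w 1\<^sup>T\<close>, where \<open>w\<close> is the stationary vector, has the same action as \<open>B\<close> on
  vectors of total 0, and its nonzero eigenvalues are the eigenvalues of \<open>B\<close> other than 1.
\<close>

lemma power_upper_bound:
  assumes r: "subdominant_modulus < r"
  shows "\<exists>K. \<forall>t. \<forall>v\<in>carrier_vec N. vec_total v = 0 \<longrightarrow> l1_norm (cmat B ^\<^sub>m t *\<^sub>v v) \<le> K * r ^ t * l1_norm v"
proof -
  have r_pos: "0 < r" using r subdominant_modulus_nonneg by linarith
  obtain w where "w \<in> carrier_vec N" "cmat B *\<^sub>v map_vec complex_of_real w = map_vec complex_of_real w" "vec_total w = 1"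
    using ex_fixed_vec by blast
  then obtain w :: "complex Matrix.vec" where w: "w \<in> carrier_vec N" "cmat B *\<^sub>v w = w" "vec_total w = 1"
    using that[of "map_vec complex_of_real w"] by (auto simp: vec_total_def simp flip: of_real_sum)
  \<comment> \<open>The deflated matrix divided by \<open>r\<close>. The division brings the
    spectral radius strictly below 1, where the Jordan normal form yields bounded powers; polynomial
    factors are absorbed in the gap between the second modulus and \<open>r\<close>.\<close>
  define C where "C = mat N N (\<lambda>(i, j). (cmat B $$ (i, j) - w $ i) / of_real r)"
  have C: "C \<in> carrier_mat N N" by (simp add: C_def)
  have C_entry: "of_real r * (C *\<^sub>v v) $ i = (cmat B *\<^sub>v v) $ i - vec_total v * w $ i"
    if "v \<in> carrier_vec N" "i < N" for v i
  proof -
    have "of_real r * (C *\<^sub>v v) $ i = (\<Sum>j<N. (cmat B $$ (i, j) - w $ i) * v $ j)"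
      using mult_mat_vec_entry[OF C that] r_pos that(2)
      by (simp add: C_def sum_distrib_left mult.assoc)
    also have "\<dots> = (cmat B *\<^sub>v v) $ i - vec_total v * w $ i"
      using mult_mat_vec_entry[OF cmat_carrier that] that
      by (simp add: vec_total_def left_diff_distrib sum_subtractf sum_distrib_right mult.commute[of "w $ i"])
    finally show ?thesis .
  qed
  have "cmod \<nu> < 1" if "eigenvalue C \<nu>" for \<nu>
  proof (cases "\<nu> = 0")
    case False
    obtain v where v: "v \<in> carrier_vec N" "v \<noteq> 0\<^sub>v N" "C *\<^sub>v v = \<nu> \<cdot>\<^sub>v v"
      using \<open>eigenvalue C \<nu>\<close> C by (auto simp: eigenvalue_def eigenvector_def)
    have e: "of_real r * \<nu> * v $ i = (cmat B *\<^sub>v v) $ i - vec_total v * w $ i" if "i < N" for i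
      using C_entry[OF v(1) that] v that by (simp add: mult.assoc)
    \<comment> \<open>Since \<open>w\<close> has total 1, the deflated matrix maps everything to
      total 0. An eigenvector for nonzero \<nu> thus has total 0 and is an eigenvector of
      \<open>B\<close> itself.\<close>
    have "of_real r * \<nu> * vec_total v = (\<Sum>i<N. of_real r * \<nu> * v $ i)"
      using v by (simp add: vec_total_def sum_distrib_left)
    also have "\<dots> = vec_total (cmat B *\<^sub>v v) - vec_total v * vec_total w"
      using e w carrier by (simp add: vec_total_def sum_subtractf flip: sum_distrib_left)
    also have "\<dots> = 0" using vec_total_cmat[OF v(1)] w by simp
    finally have t0: "vec_total v = 0" using False r_pos by simp
    have Bv: "cmat B *\<^sub>v v = (of_real r * \<nu>) \<cdot>\<^sub>v v"
      using e t0 v carrier by (intro eq_vecI) auto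
    \<comment> \<open>Otherwise \<open>v\<close> would be a nonzero fixed vector of total 0.\<close>
    have "of_real r * \<nu> \<noteq> 1" using fixed_total_0[OF v(1)] Bv t0 v by auto
    moreover have "eigenvalue (cmat B) (of_real r * \<nu>)"
      using Bv v carrier by (auto simp: eigenvalue_def eigenvector_def)
    ultimately have "cmod (of_real r * \<nu>) < r"
      using cmod_le_subdominant_modulus r by fastforce
    then show ?thesis using r_pos by (simp add: norm_mult)
  qed simp
  then have "spectral_radius C < 1"
    using spectral_radius_mem_max(1)[OF C dim_pos] by (auto simp: spectrum_def)
  then obtain c where c: "norm_bound (C ^\<^sub>m t) c" for t
    using spectral_radius_jnf_norm_bound_less_1_upper_triangular[OF C] by blast
  have Cv: "C ^\<^sub>m t *\<^sub>v v \<in> carrier_vec N" if "v \<in> carrier_vec N" for t v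
    using mult_mat_vec_carrier[OF pow_carrier_mat[OF C] that] .
  have Bv: "cmat B ^\<^sub>m t *\<^sub>v v = of_real (r ^ t) \<cdot>\<^sub>v (C ^\<^sub>m t *\<^sub>v v)"
    if v: "v \<in> carrier_vec N" "vec_total v = 0" for t v
  proof (induction t)
    case 0
    then show ?case using v C carrier by auto
  next
    case (Suc t)
    let ?u = "cmat B ^\<^sub>m t *\<^sub>v v"
    have u: "?u \<in> carrier_vec N" using mult_mat_vec_carrier[OF pow_carrier_mat[OF cmat_carrier] v(1)] .
    have "vec_total ?u = 0" using vec_total_cmat_power[OF v(1)] v by simp
    then have "cmat B *\<^sub>v ?u = of_real r \<cdot>\<^sub>v (C *\<^sub>v ?u)"
      using C_entry[OF u] C carrier by (intro eq_vecI) auto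
    also have "C *\<^sub>v ?u = of_real (r ^ t) \<cdot>\<^sub>v (C *\<^sub>v (C ^\<^sub>m t *\<^sub>v v))"
      unfolding Suc by (rule mult_mat_vec[OF C Cv[OF v(1)]])
    also have "C *\<^sub>v (C ^\<^sub>m t *\<^sub>v v) = C ^\<^sub>m Suc t *\<^sub>v v"
      by (rule pow_mat_Suc_vec(2)[OF C v(1), symmetric])
    finally show ?case
      unfolding pow_mat_Suc_vec(2)[OF cmat_carrier v(1)] by (simp add: smult_smult_assoc)
  qed
  \<comment> \<open>The factor \<open>N * c\<close> arises because each of the \<open>N\<close>
    entries of the vector propagated by \<open>C\<close> is at most
    \<open>c * l1_norm v\<close>.\<close>
  have "l1_norm (cmat B ^\<^sub>m t *\<^sub>v v) \<le> (N * c) * r ^ t * l1_norm v"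
    if v: "v \<in> carrier_vec N" "vec_total v = 0" for t v
  proof -
    have "cmod ((C ^\<^sub>m t *\<^sub>v v) $ i) \<le> c * l1_norm v" if i: "i < N" for i
    proof -
      have "cmod ((C ^\<^sub>m t *\<^sub>v v) $ i) \<le> (\<Sum>j<N. cmod ((C ^\<^sub>m t) $$ (i, j) * v $ j))"
        unfolding mult_mat_vec_entry[OF pow_carrier_mat[OF C] v(1) i] by (rule norm_sum)
      also have "\<dots> \<le> (\<Sum>j<N. c * cmod (v $ j))"
        using c[of t] C i by (intro sum_mono) (auto simp: norm_mult norm_bound_def intro!: mult_right_mono)
      also have "\<dots> = c * l1_norm v"
        using v by (simp add: l1_norm_def sum_distrib_left)
      finally show ?thesis .
    qed
    then have "(\<Sum>i<N. cmod ((C ^\<^sub>m t *\<^sub>v v) $ i)) \<le> (\<Sum>i<N. c * l1_norm v)"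
      by (intro sum_mono) simp
    also have "(\<Sum>i<N. cmod ((C ^\<^sub>m t *\<^sub>v v) $ i)) = l1_norm (C ^\<^sub>m t *\<^sub>v v)"
      using carrier_vecD[OF Cv[OF v(1), of t]] by (simp only: l1_norm_def)
    finally have "l1_norm (C ^\<^sub>m t *\<^sub>v v) \<le> N * c * l1_norm v" by simp
    then have "r ^ t * l1_norm (C ^\<^sub>m t *\<^sub>v v) \<le> r ^ t * (N * c * l1_norm v)"
      using r_pos by (intro mult_left_mono) auto
    then show ?thesis
      using r_pos unfolding Bv[OF v] l1_norm_smult by (simp add: mult_ac norm_power)
  qed
  then show ?thesis by blast
qed

section \<open>Left eigenvectors and the lower bound\<close>

text \<open>\<open>u\<close> is an eigenvector of the transpose. The pairing is bilinear, without
  conjugation, so the factor is \<mu> and not its conjugate.\<close>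

lemma left_eigenvector:
  assumes "eigenvalue (cmat B) \<mu>"
  shows "\<exists>u\<in>carrier_vec N. u \<noteq> 0\<^sub>v N \<and>
    (\<forall>v\<in>carrier_vec N. (\<Sum>i<N. u $ i * (cmat B *\<^sub>v v) $ i) = \<mu> * (\<Sum>i<N. u $ i * v $ i))"
proof -
  have T: "transpose_mat (cmat B) \<in> carrier_mat N N" using carrier by simp
  have "eigenvalue (transpose_mat (cmat B)) \<mu>"
    using assms eigenvalue_root_char_poly[OF T] eigenvalue_root_char_poly[OF cmat_carrier]
      char_poly_transpose_mat[OF cmat_carrier] by simp
  then obtain u where u: "u \<in> carrier_vec N" "u \<noteq> 0\<^sub>v N" "transpose_mat (cmat B) *\<^sub>v u = \<mu> \<cdot>\<^sub>v u"
    using carrier by (auto simp: eigenvalue_def eigenvector_def)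
  have uB: "(\<Sum>i<N. cmat B $$ (i, j) * u $ i) = \<mu> * u $ j" if "j < N" for j
    using mult_mat_vec_entry[OF T u(1) that] u that carrier by simp
  have "(\<Sum>i<N. u $ i * (cmat B *\<^sub>v v) $ i) = \<mu> * (\<Sum>i<N. u $ i * v $ i)"
    if v: "v \<in> carrier_vec N" for v
  proof -
    have "(\<Sum>i<N. u $ i * (cmat B *\<^sub>v v) $ i) = (\<Sum>i<N. \<Sum>j<N. u $ i * (cmat B $$ (i, j) * v $ j))"
      using mult_mat_vec_entry[OF cmat_carrier v] by (simp add: sum_distrib_left)
    also have "\<dots> = (\<Sum>j<N. (\<Sum>i<N. cmat B $$ (i, j) * u $ i) * v $ j)"
      by (subst sum.swap) (simp add: sum_distrib_left sum_distrib_right mult_ac)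
    also have "\<dots> = \<mu> * (\<Sum>i<N. u $ i * v $ i)"
      by (simp add: uB sum_distrib_left mult.assoc)
    finally show ?thesis .
  qed
  then show ?thesis using u by blast
qed

text \<open>Pairing with a left eigenvector \<open>u\<close> for an eigenvalue of the second largest
  modulus turns the power of \<open>B\<close> into a power of \<mu>, and a pairing is at most the
  product of the norms. The same \<open>u\<close> and \<open>M\<close> serve all starts
  \<open>x\<close>, so that failure of the bound to be informative is confined to the kernel of one
  functional.\<close>

lemma power_lower_bound:
  assumes pos: "0 < subdominant_modulus"
    and w: "w \<in> carrier_vec N" "cmat B *\<^sub>v w = w"
  shows "\<exists>u\<in>carrier_vec N. u \<noteq> 0\<^sub>v N \<and> (\<exists>M>0. \<forall>x\<in>carrier_vec N. \<forall>t.
    subdominant_modulus ^ t * cmod (\<Sum>i<N. u $ i * x $ i) \<le> M * l1_norm (cmat B ^\<^sub>m t *\<^sub>v (x - w)))"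
proof -
  obtain \<mu> where \<mu>: "eigenvalue (cmat B) \<mu>" "\<mu> \<noteq> 1" "cmod \<mu> = subdominant_modulus"
    using pos by (cases rule: subdominant_modulus_cases) auto
  obtain u where u: "u \<in> carrier_vec N" "u \<noteq> 0\<^sub>v N"
    and uB: "\<And>v. v \<in> carrier_vec N \<Longrightarrow>
      (\<Sum>i<N. u $ i * (cmat B *\<^sub>v v) $ i) = \<mu> * (\<Sum>i<N. u $ i * v $ i)"
    using left_eigenvector[OF \<mu>(1)] by blast
  \<comment> \<open>Left and right eigenvectors for different eigenvalues, \<mu> and 1, pair to 0;
    hence \<open>x - w\<close> and \<open>x\<close> have the same pairing with
    \<open>u\<close>.\<close>
  have uw: "(\<Sum>i<N. u $ i * w $ i) = 0"
    using uB[OF w(1)] w(2) \<mu>(2) by simp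
  have "subdominant_modulus ^ t * cmod (\<Sum>i<N. u $ i * x $ i) \<le> l1_norm u * l1_norm (cmat B ^\<^sub>m t *\<^sub>v (x - w))"
    if x: "x \<in> carrier_vec N" for x t
  proof -
    have xw: "x - w \<in> carrier_vec N" using x w by auto
    define y where "y t = cmat B ^\<^sub>m t *\<^sub>v (x - w)" for t
    have y: "y t \<in> carrier_vec N" for t
      unfolding y_def using mult_mat_vec_carrier[OF pow_carrier_mat[OF cmat_carrier] xw] .
    have "(\<Sum>i<N. u $ i * y t $ i) = \<mu> ^ t * (\<Sum>i<N. u $ i * x $ i)" for t
    proof (induction t)
      case 0
      have "y 0 = x - w" unfolding y_def using xw carrier by simp
      then show ?case using x w uw by (simp add: right_diff_distrib sum_subtractf)
    next
      case (Suc t)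
      have "y (Suc t) = cmat B *\<^sub>v y t"
        unfolding y_def by (rule pow_mat_Suc_vec(2)[OF cmat_carrier xw])
      then show ?case using uB[OF y] Suc by simp
    qed
    then have "subdominant_modulus ^ t * cmod (\<Sum>i<N. u $ i * x $ i) = cmod (\<Sum>i<N. u $ i * y t $ i)"
      by (simp add: norm_mult norm_power \<mu>)
    also have "\<dots> \<le> (\<Sum>i<N. cmod (u $ i * y t $ i))"
      by (rule norm_sum)
    also have "\<dots> \<le> (\<Sum>i<N. l1_norm u * cmod (y t $ i))"
    proof (rule sum_mono)
      fix i assume "i \<in> {..<N}"
      then have "cmod (u $ i) \<le> l1_norm u"
        using u unfolding l1_norm_def by (intro member_le_sum) auto
      then show "cmod (u $ i * y t $ i) \<le> l1_norm u * cmod (y t $ i)"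
        by (simp add: norm_mult mult_right_mono)
    qed
    also have "\<dots> = l1_norm u * l1_norm (y t)"
      using y[of t] by (simp add: l1_norm_def sum_distrib_left)
    finally show ?thesis by (simp add: y_def)
  qed
  moreover have "0 < l1_norm u"
    using l1_norm_nonneg[of u] l1_norm_eq_0_iff[OF u(1)] u(2) by linarith
  ultimately show ?thesis using u by blast
qed

end

section \<open>Roots and limits of geometrically bounded sequences\<close>

lemma eventually_root_less:
  fixes d :: "nat \<Rightarrow> real"
  assumes nonneg: "0 \<le> \<rho>"
    and le: "\<And>r. \<rho> < r \<Longrightarrow> \<exists>K. \<forall>t. d t \<le> K * r ^ t"
    and "\<rho> < s"
  shows "\<forall>\<^sub>F t in sequentially. root t (d t) < s"
proof -
  define r where "r = (\<rho> + s) / 2"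
  have r: "\<rho> < r" "r < s" "0 < r" using assms by (auto simp: r_def)
  obtain K where K: "\<And>t. d t \<le> K * r ^ t" using le[OF r(1)] by blast
  \<comment> \<open>\<open>K\<close> may be zero or negative, whereas the roots of a positive
    constant tend to 1.\<close>
  define L where "L = max K 1"
  have "(\<lambda>t. root t L * r) \<longlonglongrightarrow> 1 * r"
    by (intro tendsto_mult LIMSEQ_root_const tendsto_const) (simp add: L_def)
  then have "\<forall>\<^sub>F t in sequentially. root t L * r < s"
    using r by (intro order_tendstoD(2)[of _ "1 * r"]) auto
  then show ?thesis
    \<comment> \<open>\<open>root 0\<close> is constantly 0, so roots and powers cancel only for
      positive \<open>t\<close>.\<close>
    using eventually_gt_at_top[of 0]
  proof eventually_elim
    case (elim t)
    have "d t \<le> L * r ^ t"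
      using K[of t] r by (smt (verit) L_def mult_right_mono zero_le_power max.cobounded1)
    then have "root t (d t) \<le> root t (L * r ^ t)"
      using elim by simp
    also have "\<dots> = root t L * r"
      using elim r by (simp add: real_root_mult real_root_power_cancel)
    finally show ?case using elim by simp
  qed
qed

text \<open>If \<rho> is 0, nonnegativity of the roots is already the lower bound; a geometric one
  is required only for positive \<rho>.\<close>

lemma root_tendsto:
  fixes d :: "nat \<Rightarrow> real"
  assumes nonneg: "0 \<le> \<rho>" "\<And>t. 0 \<le> d t"
    and le: "\<And>r. \<rho> < r \<Longrightarrow> \<exists>K. \<forall>t. d t \<le> K * r ^ t"
    and ge: "0 < \<rho> \<Longrightarrow> \<exists>a>0. \<forall>t. a * \<rho> ^ t \<le> d t"
  shows "(\<lambda>t. root t (d t)) \<longlonglongrightarrow> \<rho>"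
proof (rule order_tendstoI)
  fix s assume "\<rho> < s"
  then show "\<forall>\<^sub>F t in sequentially. root t (d t) < s"
    using eventually_root_less[OF nonneg(1) le] by blast
next
  fix s assume s: "s < \<rho>"
  show "\<forall>\<^sub>F t in sequentially. s < root t (d t)"
  proof (cases "0 < \<rho>")
    case True
    then obtain a where a: "a > 0" "\<And>t. a * \<rho> ^ t \<le> d t" using ge by blast
    have "(\<lambda>t. root t a * \<rho>) \<longlonglongrightarrow> 1 * \<rho>"
      by (intro tendsto_mult LIMSEQ_root_const tendsto_const a)
    then have "\<forall>\<^sub>F t in sequentially. s < root t a * \<rho>"
      using s by (intro order_tendstoD(1)[of _ "1 * \<rho>"]) auto
    then show ?thesis
      using eventually_gt_at_top[of 0]
    proof eventually_elim
      case (elim t)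
      have "root t a * \<rho> = root t (a * \<rho> ^ t)"
        using elim True by (simp add: real_root_mult real_root_power_cancel)
      also have "\<dots> \<le> root t (d t)" using a elim by simp
      finally show ?case using elim by simp
    qed
  next
    case False
    then have "s < root t (d t)" for t
      using s nonneg real_root_ge_zero[of "d t" t] by (smt (verit))
    then show ?thesis by simp
  qed
qed

text \<open>Stated in \<open>ereal\<close>, where every sequence has an upper limit.\<close>

lemma limsup_root_le:
  fixes d :: "nat \<Rightarrow> real"
  assumes nonneg: "0 \<le> \<rho>"
    and le: "\<And>r. \<rho> < r \<Longrightarrow> \<exists>K. \<forall>t. d t \<le> K * r ^ t"
  shows "limsup (\<lambda>t. ereal (root t (d t))) \<le> ereal \<rho>"
proof (rule ereal_le_epsilon2)
  fix e :: real assume "0 < e"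
  then have "\<forall>\<^sub>F t in sequentially. root t (d t) < \<rho> + e"
    by (intro eventually_root_less[OF nonneg le]) auto
  then show "limsup (\<lambda>t. ereal (root t (d t))) \<le> ereal \<rho> + ereal e"
    by (intro Limsup_bounded) (auto elim: eventually_mono)
qed

lemma tendsto_0_of_geometric:
  fixes d :: "nat \<Rightarrow> real"
  assumes "\<rho> < 1" "0 \<le> \<rho>" "\<And>t. 0 \<le> d t"
    and le: "\<And>r. \<rho> < r \<Longrightarrow> \<exists>K. \<forall>t. d t \<le> K * r ^ t"
  shows "d \<longlonglongrightarrow> 0"
proof -
  obtain r where r: "\<rho> < r" "r < 1" using assms dense by blast
  obtain K where K: "\<And>t. d t \<le> K * r ^ t" using le[OF r(1)] by blast
  have "(\<lambda>t. K * r ^ t) \<longlonglongrightarrow> K * 0"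
    using r assms by (intro tendsto_mult tendsto_const LIMSEQ_power_zero) auto
  then show ?thesis
    using assms(3) K by (intro tendsto_sandwich[of "\<lambda>_. 0" d sequentially "\<lambda>t. K * r ^ t" 0]) auto
qed

section \<open>Unfolding\<close>

definition multi_index :: "nat \<Rightarrow> nat \<Rightarrow> nat \<Rightarrow> nat list" where
  "multi_index n N r = the_inv_into (midx n N) (ivec n) (r + 1)"

definition flatten :: "nat \<Rightarrow> nat \<Rightarrow> (nat list \<Rightarrow> 'a) \<Rightarrow> 'a Matrix.vec" where
  "flatten n N Y = Matrix.vec (n ^ N) (\<lambda>r. Y (multi_index n N r))"

definition unflatten :: "nat \<Rightarrow> 'a Matrix.vec \<Rightarrow> nat list \<Rightarrow> 'a" where
  "unflatten n v is = v $ (ivec n is - 1)"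

lemma flatten_carrier: "flatten n N Y \<in> carrier_vec (n ^ N)"
  by (simp add: flatten_def)

lemma flatten_index: "r < n ^ N \<Longrightarrow> flatten n N Y $ r = Y (multi_index n N r)"
  by (simp add: flatten_def)

lemma finite_midx: "finite (midx n N)"
  unfolding midx_def by (simp add: finite_lists_length_eq)

lemma last_midx:
  assumes "js \<in> midx n N" "N \<ge> 1"
  shows "last js \<in> {1..n}"
proof -
  have "js \<noteq> []" using assms by (auto simp: midx_def)
  then have "last js \<in> set js" by simp
  then show ?thesis using assms(1) unfolding midx_def by blast
qed

lemma bij_betw_multi_index:
  assumes "N \<ge> 1"
  shows "bij_betw (multi_index n N) {..<n ^ N} (midx n N)"
proof -
  have "bij_betw (\<lambda>r. r + 1) {..<n ^ N} {1..n ^ N}"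
    by (rule bij_betw_byWitness[where f' = "\<lambda>r. r - 1"]) auto
  from bij_betw_trans[OF this bij_betw_the_inv_into[OF bij_betw_ivec[OF assms]]]
  show ?thesis by (simp add: multi_index_def[abs_def] comp_def)
qed

lemma sum_midx:
  "N \<ge> 1 \<Longrightarrow> (\<Sum>is\<in>midx n N. f is) = (\<Sum>r<n ^ N. f (multi_index n N r))"
  by (rule sum.reindex_bij_betw[OF bij_betw_multi_index, symmetric])

lemma multi_index_mem: "N \<ge> 1 \<Longrightarrow> r < n ^ N \<Longrightarrow> multi_index n N r \<in> midx n N"
  using bij_betw_multi_index[of N n] by (auto simp: bij_betw_def)

lemma ball_midx:
  "N \<ge> 1 \<Longrightarrow> (\<forall>is\<in>midx n N. Q is) \<longleftrightarrow> (\<forall>r<n ^ N. Q (multi_index n N r))"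
  by (subst bij_betw_imp_surj_on[OF bij_betw_multi_index, symmetric]) auto

lemma ivec_multi_index:
  assumes "N \<ge> 1" "r < n ^ N"
  shows "ivec n (multi_index n N r) = r + 1"
  unfolding multi_index_def using assms bij_betw_ivec[OF assms(1), of n]
  by (intro f_the_inv_into_f) (auto simp: bij_betw_def)

lemma flatten_unflatten:
  "N \<ge> 1 \<Longrightarrow> v \<in> carrier_vec (n ^ N) \<Longrightarrow> flatten n N (unflatten n v) = v"
  by (rule eq_vecI) (auto simp: flatten_def unflatten_def ivec_multi_index)

lemma unfolding_mat_entry:
  "i < n ^ N \<Longrightarrow> j < n ^ N \<Longrightarrow>
    unfolding_mat n N A $$ (i, j) = A (multi_index n N i) (multi_index n N j)"
  by (simp add: unfolding_mat_def multi_index_def)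

lemma unfolding_mat_carrier: "unfolding_mat n N A \<in> carrier_mat (n ^ N) (n ^ N)"
  by (simp add: unfolding_mat_def)

lemma unfolding_mat_cplx_tensor:
  "unfolding_mat n N (cplx_tensor A) = cmat (unfolding_mat n N A)"
  by (rule eq_matI) (auto simp: unfolding_mat_def cplx_tensor_def)

text \<open>Both sides are the same sum in two numberings of the multi-indices; this carries the
  tensor problem over to matrices.\<close>

lemma unfolding_mult_flatten:
  assumes "N \<ge> 1"
  shows "unfolding_mat n N A *\<^sub>v flatten n N Y = flatten n N (einstein n N A Y)"
proof (rule eq_vecI)
  fix r assume "r < dim_vec (flatten n N (einstein n N A Y))"
  then have r: "r < n ^ N" by (simp add: flatten_def)
  show "(unfolding_mat n N A *\<^sub>v flatten n N Y) $ r = flatten n N (einstein n N A Y) $ r"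
    unfolding mult_mat_vec_entry[OF unfolding_mat_carrier flatten_carrier r] flatten_index[OF r]
      einstein_def sum_midx[OF assms]
    using r by (simp add: unfolding_mat_entry flatten_index)
qed (simp_all add: unfolding_mat_def flatten_def)

text \<open>Flattening forgets exactly the irrelevant values outside
  \<open>midx n N\<close>.\<close>

lemma flatten_eq_iff:
  assumes "N \<ge> 1"
  shows "flatten n N X = flatten n N Y \<longleftrightarrow> (\<forall>is\<in>midx n N. X is = Y is)"
  unfolding ball_midx[OF assms] by (auto simp: flatten_def vec_eq_iff)

lemma U_eigentensor_iff:
  assumes "N \<ge> 1"
  shows "U_eigentensor n N A \<mu> X \<longleftrightarrow> eigenvector (unfolding_mat n N A) (flatten n N X) \<mu>"
proof -
  have "(\<exists>is\<in>midx n N. X is \<noteq> 0) \<longleftrightarrow> flatten n N X \<noteq> flatten n N (\<lambda>_. 0)"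
    unfolding flatten_eq_iff[OF assms] by blast
  also have "flatten n N (\<lambda>_. 0 :: complex) = 0\<^sub>v (n ^ N)"
    by (simp add: flatten_def zero_vec_def)
  finally have 1: "(\<exists>is\<in>midx n N. X is \<noteq> 0) \<longleftrightarrow> flatten n N X \<noteq> 0\<^sub>v (n ^ N)" .
  have "(\<forall>is\<in>midx n N. einstein n N A X is = \<mu> * X is)
      \<longleftrightarrow> flatten n N (einstein n N A X) = flatten n N (\<lambda>is. \<mu> * X is)"
    by (rule flatten_eq_iff[OF assms, symmetric])
  also have "flatten n N (\<lambda>is. \<mu> * X is) = \<mu> \<cdot>\<^sub>v flatten n N X"
    by (rule eq_vecI) (auto simp: flatten_def)
  finally have 2: "(\<forall>is\<in>midx n N. einstein n N A X is = \<mu> * X is)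
      \<longleftrightarrow> unfolding_mat n N A *\<^sub>v flatten n N X = \<mu> \<cdot>\<^sub>v flatten n N X"
    unfolding unfolding_mult_flatten[OF assms] .
  have "dim_row (unfolding_mat n N A) = n ^ N" by (simp add: unfolding_mat_def)
  then show ?thesis
    unfolding U_eigentensor_def eigenvector_def 1 2 using flatten_carrier[of n N X] by simp
qed

lemma U_eigenvalue_iff:
  assumes "N \<ge> 1"
  shows "U_eigenvalue n N A \<mu> \<longleftrightarrow> eigenvalue (unfolding_mat n N A) \<mu>"
proof
  assume "eigenvalue (unfolding_mat n N A) \<mu>"
  then obtain v where v: "eigenvector (unfolding_mat n N A) v \<mu>" by (auto simp: eigenvalue_def)
  then have "v \<in> carrier_vec (n ^ N)" by (simp add: eigenvector_def unfolding_mat_def)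
  then show "U_eigenvalue n N A \<mu>"
    using v unfolding U_eigenvalue_def U_eigentensor_iff[OF assms]
    by (intro exI[of _ "unflatten n v"]) (simp add: flatten_unflatten[OF assms])
qed (auto simp: U_eigenvalue_def U_eigentensor_iff[OF assms] eigenvalue_def)

section \<open>The paired tensor as a stochastic matrix of memories\<close>

text \<open>In row \<open>is\<close>, the only columns that can contribute are those overlapping
  \<open>is\<close> in all but their last state, so the sum over \<open>js\<close> reduces to a sum
  over that oldest state.\<close>

lemma memory_update_eq_einstein:
  assumes "is \<in> midx n N" "N \<ge> 1"
  shows "memory_update n p \<pi> is = einstein n N (paired_tensor p) \<pi> is"
proof -
  let ?S = "{js \<in> midx n N. js = tl is @ [last js]}"
  have len: "length is = N" and "set is \<subseteq> {1..n}" using assms(1) by (auto simp: midx_def)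
  then have tl: "set (tl is) \<subseteq> {1..n}" "Suc (length (tl is)) = N"
    using assms(2) by (cases "is"; auto)+
  have "einstein n N (paired_tensor p) \<pi> is = (\<Sum>js\<in>?S. p (is @ [last js]) * \<pi> js)"
    unfolding einstein_def paired_tensor_def
    by (rule sum.mono_neutral_cong_right) (auto simp: finite_midx)
  also have "\<dots> = (\<Sum>i=1..n. p (is @ [i]) * \<pi> (tl is @ [i]))"
    by (rule sum.reindex_bij_witness[of _ "\<lambda>i. tl is @ [i]" last])
      (use tl last_midx[OF _ assms(2)] in \<open>auto simp: midx_def\<close>)
  finally show ?thesis by (simp add: memory_update_def)
qed

text \<open>In column \<open>js\<close> the supporting rows are \<open>i # butlast js\<close>.
  Appending \<open>last js\<close> to such a row gives \<open>i # js\<close>, so the column sum is a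
  sum of transition probabilities out of the history \<open>js\<close>.\<close>

lemma paired_tensor_column_sum:
  assumes "transition_tensor n m p" "m \<ge> 2" "js \<in> midx n (m - 1)"
  shows "(\<Sum>is\<in>midx n (m - 1). paired_tensor p is js) = 1"
proof -
  let ?S = "{is \<in> midx n (m - 1). js = tl is @ [last js]}"
  have js: "js \<noteq> []" "set js \<subseteq> {1..n}" "length js = m - 1"
    using assms by (auto simp: midx_def)
  then have "set (butlast js) \<subseteq> {1..n}" by (meson in_set_butlastD subset_iff)
  have "(\<Sum>is\<in>midx n (m - 1). paired_tensor p is js) = (\<Sum>is\<in>?S. p (is @ [last js]))"
    unfolding paired_tensor_def by (rule sum.mono_neutral_cong_right) (auto simp: finite_midx)
  also have "\<dots> = (\<Sum>i=1..n. p (i # js))"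
  proof (rule sum.reindex_bij_witness[of _ "\<lambda>i. i # butlast js" hd])
    fix "is" assume a: "is \<in> ?S"
    then have "is \<noteq> []" "set is \<subseteq> {1..n}" using assms(2) by (auto simp: midx_def)
    then obtain i is' where i: "is = i # is'" by (cases "is") auto
    have "js = is' @ [last js]" using a i by auto
    then have "butlast js = is'" by (metis butlast_snoc)
    then show "hd is # butlast js = is" using i by simp
    show "hd is \<in> {1..n}" using i \<open>set is \<subseteq> {1..n}\<close> by simp
    show "p (hd is # js) = p (is @ [last js])"
      using i \<open>js = is' @ [last js]\<close> by simp
  next
    fix i assume "i \<in> {1..n}"
    then show "i # butlast js \<in> ?S"
      using js \<open>set (butlast js) \<subseteq> {1..n}\<close> assms(2) by (auto simp: midx_def)
  qed auto
  also have "\<dots> = 1" using assms by (auto simp: transition_tensor_def)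
  finally show ?thesis .
qed

lemma paired_tensor_nonneg:
  assumes "transition_tensor n m p" "m \<ge> 2" "is \<in> midx n (m - 1)" "js \<in> midx n (m - 1)"
  shows "0 \<le> paired_tensor p is js"
proof -
  have "last js \<in> {1..n}" using assms last_midx[of js n "m - 1"] by auto
  then have "is @ [last js] \<in> midx n m" using assms by (auto simp: midx_def)
  then show ?thesis using assms(1) by (auto simp: paired_tensor_def transition_tensor_def)
qed

lemma primitive_stochastic_unfolding:
  assumes "n \<ge> 1" "m \<ge> 2" "transition_tensor n m p" "U_primitive n (m - 1) (paired_tensor p)"
  shows "\<exists>k. primitive_stochastic (n ^ (m - 1)) (unfolding_mat n (m - 1) (paired_tensor p)) k"
proof -
  let ?N = "n ^ (m - 1)" and ?B = "unfolding_mat n (m - 1) (paired_tensor p)"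
  have L: "m - 1 \<ge> 1" using assms by simp
  have dim: "dim_row ?B = ?N" "dim_col ?B = ?N" by (simp_all add: unfolding_mat_def)
  obtain k where "\<forall>i<?N. \<forall>j<?N. (?B ^\<^sub>m k) $$ (i, j) > 0"
    using assms(4) unfolding U_primitive_def primitive_mat_def dim by blast
  then have "primitive_stochastic ?N ?B k"
  proof (unfold_locales, goal_cases)
    \<comment> \<open>Goal 4 is \<open>column_sum\<close>, and goal 3 below is
      \<open>nonneg\<close>.\<close>
    case 4
    then show ?case
      using paired_tensor_column_sum[OF assms(3,2) multi_index_mem[OF L], unfolded sum_midx[OF L]]
      by (simp add: unfolding_mat_entry)
  next
    case 3
    then show ?case
      using paired_tensor_nonneg[OF assms(3,2) multi_index_mem[OF L] multi_index_mem[OF L]]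
      by (simp add: unfolding_mat_entry)
  qed (use assms(1) in \<open>auto simp: unfolding_mat_def\<close>)
  then show ?thesis by blast
qed

definition cflatten :: "nat \<Rightarrow> nat \<Rightarrow> (nat list \<Rightarrow> real) \<Rightarrow> complex Matrix.vec" where
  "cflatten n N Y = flatten n N (\<lambda>is. complex_of_real (Y is))"

lemma cflatten_carrier: "cflatten n N Y \<in> carrier_vec (n ^ N)"
  by (simp add: cflatten_def flatten_carrier)

lemma vec_total_cflatten: "N \<ge> 1 \<Longrightarrow> vec_total (cflatten n N Y) = of_real (\<Sum>is\<in>midx n N. Y is)"
  by (simp add: cflatten_def vec_total_def flatten_def sum_midx)

lemma tensor_dist_nonneg: "0 \<le> tensor_dist n N X Y"
  by (simp add: tensor_dist_def sum_nonneg)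

lemma tensor_dist_eq_l1_norm:
  "N \<ge> 1 \<Longrightarrow> tensor_dist n N X Y = l1_norm (cflatten n N X - cflatten n N Y)"
  by (simp add: cflatten_def l1_norm_def flatten_def sum_midx tensor_dist_def flip: of_real_diff)

lemma cflatten_memory_update:
  assumes "N \<ge> 1"
  shows "cflatten n N (memory_update n p Y)
    = cmat (unfolding_mat n N (paired_tensor p)) *\<^sub>v cflatten n N Y"
  unfolding cflatten_def unfolding_mat_cplx_tensor[symmetric] unfolding_mult_flatten[OF assms]
    flatten_eq_iff[OF assms]
  using assms by (auto simp: memory_update_eq_einstein einstein_def cplx_tensor_def)

lemma cflatten_memory_dist:
  assumes "N \<ge> 1"
  shows "cflatten n N (memory_dist n p Y t)
    = cmat (unfolding_mat n N (paired_tensor p)) ^\<^sub>m t *\<^sub>v cflatten n N Y"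
proof (induction t)
  case 0
  then show ?case
    using cflatten_carrier[of n N Y] by (simp add: memory_dist_def unfolding_mat_def)
next
  case (Suc t)
  have "cmat (unfolding_mat n N (paired_tensor p)) \<in> carrier_mat (n ^ N) (n ^ N)"
    using unfolding_mat_carrier by simp
  from pow_mat_Suc_vec(2)[OF this cflatten_carrier, of t Y] Suc show ?case
    by (simp add: memory_dist_def cflatten_memory_update[OF assms])
qed

section \<open>The chain as a process\<close>

text \<open>The law of total probability along a variable with finite range.\<close>

lemma (in prob_space) prob_eq_sum:
  assumes "finite I" "\<And>i. i \<in> I \<Longrightarrow> {\<omega> \<in> space M. Y \<omega> = i \<and> Q \<omega>} \<in> events"
    and "\<And>\<omega>. \<omega> \<in> space M \<Longrightarrow> Y \<omega> \<in> I"
  shows "\<P>(\<omega> in M. Q \<omega>) = (\<Sum>i\<in>I. \<P>(\<omega> in M. Y \<omega> = i \<and> Q \<omega>))"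
proof -
  have "{\<omega> \<in> space M. Q \<omega>} = (\<Union>i\<in>I. {\<omega> \<in> space M. Y \<omega> = i \<and> Q \<omega>})"
    using assms(3) by auto
  then show ?thesis
    using assms(1,2) by (auto intro!: finite_measure_finite_Union simp: disjoint_family_on_def)
qed

lemma memory_Suc:
  assumes "m \<ge> 2"
  shows "memory X m (Suc t) \<omega> = X (int t + 1) \<omega> # butlast (memory X m t \<omega>)"
proof -
  obtain l where l: "m - 1 = Suc l" using assms by (cases "m - 1") auto
  \<comment> \<open>Position 0 is the new state; position \<open>k + 1\<close> at time
    \<open>t + 1\<close> is position \<open>k\<close> at time \<open>t\<close>.\<close>
  have "[0..<Suc l] = 0 # map Suc [0..<l]"
    by (simp add: map_Suc_upt upt_conv_Cons del: upt_Suc)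
  then have "memory X m (Suc t) \<omega> = X (int t + 1) \<omega> # map (\<lambda>k. X (int t - int k) \<omega>) [0..<l]"
    unfolding memory_def l by (simp add: comp_def algebra_simps del: upt_Suc)
  also have "map (\<lambda>k. X (int t - int k) \<omega>) [0..<l] = butlast (memory X m t \<omega>)"
    unfolding memory_def l by (simp add: butlast_append)
  finally show ?thesis .
qed

lemma hd_memory: "m \<ge> 2 \<Longrightarrow> hd (memory X m t \<omega>) = X (int t) \<omega>"
  by (simp add: memory_def hd_map)

locale memory_process = prob_space M for M :: "'a measure" +
  fixes n m :: nat and p :: "nat list \<Rightarrow> real" and X :: "int \<Rightarrow> 'a \<Rightarrow> nat"
  assumes depth: "m \<ge> 2"
    and chain: "memory_chain n m p M X"
begin

lemma state_range:
  assumes "s \<ge> 2 - int m" "\<omega> \<in> space M"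
  shows "X s \<omega> \<in> {1..n}"
  using chain assms measurable_space[of "X s" M "count_space {1..n}" \<omega>]
  by (auto simp: memory_chain_def)

lemma state_event:
  assumes "s \<ge> 2 - int m"
  shows "{\<omega> \<in> space M. X s \<omega> = i} \<in> events"
proof -
  have "X s \<in> measurable M (count_space {1..n})"
    using chain assms by (auto simp: memory_chain_def)
  then have "X s -` ({i} \<inter> {1..n}) \<inter> space M \<in> events"
    by (rule measurable_sets) simp
  also have "X s -` ({i} \<inter> {1..n}) \<inter> space M = {\<omega> \<in> space M. X s \<omega> = i}"
    using state_range[OF assms] by auto
  finally show ?thesis .
qed

text \<open>The oldest time in the memory is \<open>t - (m - 2)\<close>, which for
  \<open>t = 0\<close> is exactly the first time \<open>2 - m\<close> at which the process is
  given.\<close>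

lemma memory_range: "\<omega> \<in> space M \<Longrightarrow> memory X m t \<omega> \<in> midx n (m - 1)"
  using state_range[of _ \<omega>] depth by (auto simp: midx_def memory_def)

lemma memory_event: "{\<omega> \<in> space M. memory X m t \<omega> = is} \<in> events"
proof (cases "length is = m - 1")
  case True
  have "{\<omega> \<in> space M. memory X m t \<omega> = is}
      = {\<omega> \<in> space M. \<forall>k\<in>{..<m - 1}. X (int t - int k) \<omega> = is ! k}"
    using True by (auto simp: memory_def list_eq_iff_nth_eq)
  also have "\<dots> \<in> events"
    using depth by (intro sets.sets_Collect_finite_All state_event) auto
  finally show ?thesis .
next
  case False
  then have "{\<omega> \<in> space M. memory X m t \<omega> = is} = {}" by (auto simp: memory_def)
  then show ?thesis by (simp only: sets.empty_sets)
qed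

lemma joint_pmf_memory_law: "joint_pmf n (m - 1) (memory_law M X m t)"
proof -
  have "1 = \<P>(\<omega> in M. True)" using prob_space by simp
  also have "\<dots> = (\<Sum>is\<in>midx n (m - 1). \<P>(\<omega> in M. memory X m t \<omega> = is \<and> True))"
    by (rule prob_eq_sum[OF finite_midx _ memory_range]) (simp_all add: memory_event)
  finally show ?thesis
    by (simp add: joint_pmf_def memory_law_def)
qed

text \<open>Condition on the previous memory \<open>js\<close>. Two consecutive memories must
  overlap, and given the overlap their joint event says only that \<open>js\<close> is followed by
  the new state \<open>hd is\<close>.\<close>

lemma memory_law_Suc:
  assumes "is": "is \<in> midx n (m - 1)"
  shows "memory_law M X m (Suc t) is = einstein n (m - 1) (paired_tensor p) (memory_law M X m t) is"
proof -
  obtain i is' where i: "is = i # is'" "i \<in> {1..n}"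
    using "is" depth by (cases "is") (auto simp: midx_def)
  have ev: "{\<omega> \<in> space M. X (int t + 1) \<omega> = i \<and> memory X m t \<omega> = js} \<in> events" for i js t
    using depth by (intro sets.sets_Collect_conj state_event memory_event) auto
  have joint: "\<P>(\<omega> in M. memory X m t \<omega> = js \<and> memory X m (Suc t) \<omega> = is)
      = paired_tensor p is js * memory_law M X m t js" if js: "js \<in> midx n (m - 1)" for js
  proof (cases "js = tl is @ [last js]")
    case True
    then have "butlast js = butlast (is' @ [last js])" using i by simp
    then have "butlast js = is'" by simp
    then have "(memory X m t \<omega> = js \<and> memory X m (Suc t) \<omega> = is)
        \<longleftrightarrow> X (int t + 1) \<omega> = i \<and> memory X m t \<omega> = js" for \<omega>
      using i by (auto simp: memory_Suc[OF depth])
    then have "\<P>(\<omega> in M. memory X m t \<omega> = js \<and> memory X m (Suc t) \<omega> = is)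
        = \<P>(\<omega> in M. X (int t + 1) \<omega> = i \<and> memory X m t \<omega> = js)" by simp
    also have "\<dots> = p (i # js) * memory_law M X m t js"
    \<comment> \<open>The chain prescribes conditional probabilities only for histories of nonzero
      probability; for the others both sides are 0.\<close>
    proof (cases "memory_law M X m t js = 0")
      case True
      have "\<P>(\<omega> in M. X (int t + 1) \<omega> = i \<and> memory X m t \<omega> = js) \<le> memory_law M X m t js"
        unfolding memory_law_def using memory_event by (intro finite_measure_mono) auto
      then show ?thesis using True by (simp add: measure_le_0_iff)
    next
      case False
      then have "\<P>(\<omega> in M. X (int t + 1) \<omega> = i \<bar> memory X m t \<omega> = js) = p (i # js)"
        using chain i js by (auto simp: memory_chain_def)
      then show ?thesis using False by (auto simp: cond_prob_def memory_law_def field_simps)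
    qed
    also have "p (i # js) = paired_tensor p is js"
      using True i by (simp add: paired_tensor_def)
    finally show ?thesis .
  next
    case False
    have "\<not> (memory X m t \<omega> = js \<and> memory X m (Suc t) \<omega> = is)" for \<omega>
    proof
      assume a: "memory X m t \<omega> = js \<and> memory X m (Suc t) \<omega> = is"
      have "js \<noteq> []" using js depth by (auto simp: midx_def)
      moreover have "butlast js = tl is" using a memory_Suc[OF depth, of X t \<omega>] by auto
      ultimately show False using False using append_butlast_last_id[of js] by simp
    qed
    then have "\<P>(\<omega> in M. memory X m t \<omega> = js \<and> memory X m (Suc t) \<omega> = is) = 0"
      by (simp only: simp_thms) simp
    then show ?thesis using False by (simp add: paired_tensor_def)
  qed
  have "memory_law M X m (Suc t) is
      = (\<Sum>js\<in>midx n (m - 1). \<P>(\<omega> in M. memory X m t \<omega> = js \<and> memory X m (Suc t) \<omega> = is))"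
    unfolding memory_law_def
    by (intro prob_eq_sum[OF finite_midx _ memory_range] sets.sets_Collect_conj memory_event)
  then show ?thesis by (simp add: joint einstein_def)
qed

text \<open>Agreement on \<open>midx\<close> carries the induction, since the Einstein product
  evaluates its argument only there.\<close>

lemma memory_law_eq_memory_dist:
  "is \<in> midx n (m - 1) \<Longrightarrow> memory_law M X m t is = memory_dist n p (memory_law M X m 0) t is"
proof (induction t arbitrary: "is")
  case 0
  then show ?case by (simp add: memory_dist_def)
next
  case (Suc t)
  have "memory_dist n p (memory_law M X m 0) (Suc t) is
      = einstein n (m - 1) (paired_tensor p) (memory_dist n p (memory_law M X m 0) t) is"
    using memory_update_eq_einstein[OF Suc.prems] depth by (simp add: memory_dist_def)
  also have "\<dots> = einstein n (m - 1) (paired_tensor p) (memory_law M X m t) is"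
    using Suc.IH by (simp add: einstein_def)
  finally show ?case using memory_law_Suc[OF Suc.prems] by simp
qed

lemma state_prob_eq_marginal:
  assumes "i \<in> {1..n}"
  shows "\<P>(\<omega> in M. X (int t) \<omega> = i) = state_marginal n (m - 1) (memory_law M X m t) i"
proof -
  let ?S = "{is \<in> midx n (m - 1). hd is = i}"
  have "\<P>(\<omega> in M. X (int t) \<omega> = i)
      = (\<Sum>is\<in>midx n (m - 1). \<P>(\<omega> in M. memory X m t \<omega> = is \<and> X (int t) \<omega> = i))"
    using depth
    by (intro prob_eq_sum[OF finite_midx _ memory_range] sets.sets_Collect_conj memory_event state_event) auto
  also have "\<dots> = (\<Sum>is\<in>midx n (m - 1). if hd is = i then memory_law M X m t is else 0)"
  proof (rule sum.cong)
    fix "is"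
    have "(memory X m t \<omega> = is \<and> X (int t) \<omega> = i) \<longleftrightarrow> hd is = i \<and> memory X m t \<omega> = is" for \<omega>
      using hd_memory[OF depth, of X t \<omega>] by auto
    then show "\<P>(\<omega> in M. memory X m t \<omega> = is \<and> X (int t) \<omega> = i)
        = (if hd is = i then memory_law M X m t is else 0)"
      by (simp add: memory_law_def)
  qed simp
  also have "\<dots> = (\<Sum>is\<in>?S. memory_law M X m t is)"
    by (rule sum.mono_neutral_cong_right) (auto simp: finite_midx)
  also have "\<dots> = (\<Sum>js\<in>midx n (m - 1 - 1). memory_law M X m t (i # js))"
  proof (rule sum.reindex_bij_witness[of _ "(#) i" tl])
    fix "is" assume "is \<in> ?S"
    moreover then obtain j js where "is = j # js" using depth by (cases "is") (auto simp: midx_def)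
    ultimately show "i # tl is = is" "tl is \<in> midx n (m - 1 - 1)"
      "memory_law M X m t (i # tl is) = memory_law M X m t is"
      by (auto simp: midx_def)
  qed (use assms depth in \<open>auto simp: midx_def\<close>)
  finally show ?thesis by (simp add: state_marginal_def)
qed

end

section \<open>The stationary tensor\<close>

text \<open>The stationary tensor is a parameter, so that the spectral, limit and rate statements
  all concern the same \<pi>'. That such a tensor exists is shown afterwards.\<close>

locale stationary_memory =
  primitive_stochastic "n ^ (m - 1)" "unfolding_mat n (m - 1) (paired_tensor p)" k
  for n m :: nat and p :: "nat list \<Rightarrow> real" and k :: nat +
  fixes \<pi>' :: "nat list \<Rightarrow> real"
  assumes depth: "m \<ge> 2"
    and pmf: "joint_pmf n (m - 1) \<pi>'"
    and fixed: "cmat (unfolding_mat n (m - 1) (paired_tensor p)) *\<^sub>v cflatten n (m - 1) \<pi>'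
      = cflatten n (m - 1) \<pi>'"
begin

abbreviation (input) A :: "complex mat" where
  "A \<equiv> cmat (unfolding_mat n (m - 1) (paired_tensor p))"

lemma order_pos: "1 \<le> m - 1"
  using depth by simp

lemma U_eigenvalue_iff_A: "U_eigenvalue n (m - 1) (cplx_tensor (paired_tensor p)) \<mu> \<longleftrightarrow> eigenvalue A \<mu>"
  unfolding U_eigenvalue_iff[OF order_pos] unfolding_mat_cplx_tensor ..

lemma second_U_modulus_eq:
  "second_U_modulus n (m - 1) (cplx_tensor (paired_tensor p)) = subdominant_modulus"
  unfolding second_U_modulus_def subdominant_modulus_def U_eigenvalue_iff_A ..

lemma vec_total_stationary: "vec_total (cflatten n (m - 1) \<pi>') = 1"
  using pmf unfolding vec_total_cflatten[OF order_pos] joint_pmf_def by simp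

lemma U_eigentensor_stationary:
  "U_eigentensor n (m - 1) (cplx_tensor (paired_tensor p)) 1 (\<lambda>is. complex_of_real (\<pi>' is))"
proof -
  have "cflatten n (m - 1) \<pi>' \<noteq> 0\<^sub>v (n ^ (m - 1))"
    using vec_total_stationary by (auto simp: vec_total_def)
  moreover have "flatten n (m - 1) (\<lambda>is. complex_of_real (\<pi>' is)) = cflatten n (m - 1) \<pi>'"
    by (simp only: cflatten_def)
  ultimately show ?thesis
    unfolding U_eigentensor_iff[OF order_pos] unfolding_mat_cplx_tensor eigenvector_def
    using fixed cflatten_carrier[of n "m - 1" \<pi>'] by (simp add: unfolding_mat_def)
qed

lemma U_eigentensor_1_unique:
  assumes "U_eigentensor n (m - 1) (cplx_tensor (paired_tensor p)) 1 Y"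
  shows "\<exists>c. \<forall>is\<in>midx n (m - 1). Y is = c * complex_of_real (\<pi>' is)"
proof -
  have "A *\<^sub>v flatten n (m - 1) Y = flatten n (m - 1) Y"
    using assms unfolding U_eigentensor_iff[OF order_pos] unfolding_mat_cplx_tensor eigenvector_def
    by simp
  from fixed_eq[OF flatten_carrier this cflatten_carrier fixed vec_total_stationary]
  have "flatten n (m - 1) Y = vec_total (flatten n (m - 1) Y) \<cdot>\<^sub>v cflatten n (m - 1) \<pi>'" .
  also have "\<dots> = flatten n (m - 1) (\<lambda>is. vec_total (flatten n (m - 1) Y) * complex_of_real (\<pi>' is))"
    by (rule eq_vecI) (auto simp: cflatten_def flatten_def)
  finally show ?thesis
    unfolding flatten_eq_iff[OF order_pos] by blast
qed

text \<open>\<pi>' is fixed by every power of \<open>A\<close>, so the error at time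
  \<open>t\<close> is the initial error propagated linearly.\<close>

lemma tensor_dist_memory_dist:
  "tensor_dist n (m - 1) (memory_dist n p \<pi>0 t) \<pi>'
    = l1_norm (A ^\<^sub>m t *\<^sub>v (cflatten n (m - 1) \<pi>0 - cflatten n (m - 1) \<pi>'))"
proof -
  have "eigenvector A (cflatten n (m - 1) \<pi>') 1"
    using U_eigentensor_stationary
    unfolding U_eigentensor_iff[OF order_pos] unfolding_mat_cplx_tensor cflatten_def .
  from eigenvector_pow[OF cmat_carrier this]
  have "A ^\<^sub>m t *\<^sub>v cflatten n (m - 1) \<pi>' = cflatten n (m - 1) \<pi>'" by simp
  moreover have "A ^\<^sub>m t *\<^sub>v (cflatten n (m - 1) \<pi>0 - cflatten n (m - 1) \<pi>')
      = A ^\<^sub>m t *\<^sub>v cflatten n (m - 1) \<pi>0 - A ^\<^sub>m t *\<^sub>v cflatten n (m - 1) \<pi>'"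
    by (rule mult_minus_distrib_mat_vec[OF pow_carrier_mat[OF cmat_carrier] cflatten_carrier cflatten_carrier])
  ultimately show ?thesis
    unfolding tensor_dist_eq_l1_norm[OF order_pos] cflatten_memory_dist[OF order_pos] by simp
qed

lemma tensor_dist_geometric:
  assumes "joint_pmf n (m - 1) \<pi>0" "subdominant_modulus < r"
  shows "\<exists>K. \<forall>t. tensor_dist n (m - 1) (memory_dist n p \<pi>0 t) \<pi>' \<le> K * r ^ t"
proof -
  let ?v = "cflatten n (m - 1) \<pi>0 - cflatten n (m - 1) \<pi>'"
  have v: "?v \<in> carrier_vec (n ^ (m - 1))"
    by (rule minus_carrier_vec[OF cflatten_carrier cflatten_carrier])
  have "vec_total (cflatten n (m - 1) \<pi>0) = 1"
    using assms unfolding vec_total_cflatten[OF order_pos] joint_pmf_def by simp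
  then have "vec_total ?v = 0"
    using vec_total_stationary by (simp add: vec_total_minus[OF cflatten_carrier cflatten_carrier])
  then obtain K where "l1_norm (A ^\<^sub>m t *\<^sub>v ?v) \<le> K * r ^ t * l1_norm ?v" for t
    using power_upper_bound[OF assms(2)] v by blast
  then show ?thesis
    unfolding tensor_dist_memory_dist by (intro exI[of _ "K * l1_norm ?v"]) (simp add: mult_ac)
qed

lemma tensor_dist_tendsto_0:
  assumes "joint_pmf n (m - 1) \<pi>0"
  shows "(\<lambda>t. tensor_dist n (m - 1) (memory_dist n p \<pi>0 t) \<pi>') \<longlonglongrightarrow> 0"
  by (rule tendsto_0_of_geometric[OF subdominant_modulus_less_1 subdominant_modulus_nonneg
        tensor_dist_nonneg tensor_dist_geometric[OF assms]])

lemma memory_dist_tendsto: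
  assumes "joint_pmf n (m - 1) \<pi>0" "is \<in> midx n (m - 1)"
  shows "(\<lambda>t. memory_dist n p \<pi>0 t is) \<longlonglongrightarrow> \<pi>' is"
proof -
  have "\<bar>memory_dist n p \<pi>0 t is - \<pi>' is\<bar> \<le> tensor_dist n (m - 1) (memory_dist n p \<pi>0 t) \<pi>'" for t
    unfolding tensor_dist_def using assms(2)
    by (intro member_le_sum[of "is" _ "\<lambda>is. \<bar>memory_dist n p \<pi>0 t is - \<pi>' is\<bar>"]) (auto simp: finite_midx)
  then have "(\<lambda>t. memory_dist n p \<pi>0 t is - \<pi>' is) \<longlonglongrightarrow> 0"
    by (intro Lim_null_comparison[OF _ tensor_dist_tendsto_0[OF assms(1)]]) simp
  then show ?thesis by (rule LIM_zero_cancel)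
qed

lemma Cons_midx: "i \<in> {1..n} \<Longrightarrow> js \<in> midx n (m - 1 - 1) \<Longrightarrow> i # js \<in> midx n (m - 1)"
  using depth by (auto simp: midx_def)

lemma state_marginal_tendsto:
  assumes "joint_pmf n (m - 1) \<pi>0" "i \<in> {1..n}"
  shows "(\<lambda>t. state_marginal n (m - 1) (memory_dist n p \<pi>0 t) i) \<longlonglongrightarrow> state_marginal n (m - 1) \<pi>' i"
  unfolding state_marginal_def
  using memory_dist_tendsto[OF assms(1) Cons_midx[OF assms(2)]] by (intro tendsto_sum)

text \<open>For the start \<pi>' the initial error is the zero vector, and linear propagation keeps
  it zero.\<close>

lemma memory_dist_stationary:
  assumes "is \<in> midx n (m - 1)"
  shows "memory_dist n p \<pi>' t is = \<pi>' is"
proof -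
  have "tensor_dist n (m - 1) (memory_dist n p \<pi>' t) \<pi>' = 0"
    unfolding tensor_dist_memory_dist l1_norm_def
    using mult_mat_vec_entry[OF pow_carrier_mat[OF cmat_carrier, of t],
        of "cflatten n (m - 1) \<pi>' - cflatten n (m - 1) \<pi>'"] cflatten_carrier[of n "m - 1" \<pi>']
    by (simp add: unfolding_mat_def)
  then show ?thesis
    using assms by (simp add: tensor_dist_def sum_nonneg_eq_0_iff finite_midx)
qed

lemma stationary_distribution_marginal:
  "stationary_distribution n m p (state_marginal n (m - 1) \<pi>')"
  unfolding stationary_distribution_def state_marginal_def
  using pmf memory_dist_stationary[OF Cons_midx] by (intro exI[of _ \<pi>']) simp

text \<open>For a suitable start the marginals are constantly \<open>x\<close>, while from any start
  they tend to the marginal of \<pi>'.\<close>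

lemma stationary_distribution_unique:
  assumes "stationary_distribution n m p x" "i \<in> {1..n}"
  shows "x i = state_marginal n (m - 1) \<pi>' i"
proof -
  obtain \<pi>0 where \<pi>0: "joint_pmf n (m - 1) \<pi>0"
    "\<And>t. state_marginal n (m - 1) (memory_dist n p \<pi>0 t) i = x i"
    using assms by (auto simp: stationary_distribution_def)
  from state_marginal_tendsto[OF this(1) assms(2)] show ?thesis
    unfolding \<pi>0(2) by (simp add: LIMSEQ_const_iff)
qed

text \<open>
  The hyperplane is the kernel of a real functional obtained from a left eigenvector \<open>u\<close> for a
  subdominant eigenvalue \<open>\<mu>\<close>: along the iteration, the value of \<open>u\<close> is multiplied by \<open>\<mu>\<close> in
  each step. Multiplying \<open>u\<close> by the phase \<open>z\<close> makes one of its entries real and positive.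
\<close>

lemma generic_rate:
  "generic_joint_pmf n (m - 1) (\<lambda>\<pi>0.
    (\<lambda>t. root t (tensor_dist n (m - 1) (memory_dist n p \<pi>0 t) \<pi>')) \<longlonglongrightarrow> subdominant_modulus)"
proof (cases "0 < subdominant_modulus")
  case False
  have "(\<lambda>t. root t (tensor_dist n (m - 1) (memory_dist n p \<pi>0 t) \<pi>')) \<longlonglongrightarrow> subdominant_modulus"
    if "joint_pmf n (m - 1) \<pi>0" for \<pi>0
    using False
    by (intro root_tendsto[OF subdominant_modulus_nonneg tensor_dist_nonneg tensor_dist_geometric[OF that]]) auto
  \<comment> \<open>If the second modulus is 0, no start is exceptional: the constant functional is
    1 on every joint distribution, so its kernel excludes none.\<close>
  moreover have "(\<Sum>is\<in>midx n (m - 1). 1 * \<pi>' is) \<noteq> 0"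
    using pmf by (simp add: joint_pmf_def)
  ultimately show ?thesis
    unfolding generic_joint_pmf_def using pmf by (intro exI[of _ "\<lambda>_. 1"]) blast
next
  case True
  obtain u M where u: "u \<in> carrier_vec (n ^ (m - 1))" "u \<noteq> 0\<^sub>v (n ^ (m - 1))" and M: "M > 0"
    and ge: "\<And>x t. x \<in> carrier_vec (n ^ (m - 1)) \<Longrightarrow>
      subdominant_modulus ^ t * cmod (\<Sum>i<n ^ (m - 1). u $ i * x $ i)
        \<le> M * l1_norm (A ^\<^sub>m t *\<^sub>v (x - cflatten n (m - 1) \<pi>'))"
    using power_lower_bound[OF True cflatten_carrier fixed] by blast
  obtain l where l: "l < n ^ (m - 1)" "u $ l \<noteq> 0"
    using u by (metis carrier_vecD eq_vecI index_zero_vec)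
  define z where "z = cnj (u $ l) / of_real (cmod (u $ l))"
  have z: "cmod z = 1" "Re (z * u $ l) = cmod (u $ l)"
    using l by (auto simp: z_def norm_divide complex_norm_square[symmetric] mult.commute[of "cnj _"]
        power2_eq_square simp flip: of_real_mult)
  define c where "c is = Re (z * unflatten n u is)" for "is"
  \<comment> \<open>Where the real functional \<open>c\<close> is nonzero, the complex pairing with
    \<open>u\<close> is nonzero as well, which makes the lower bound effective.\<close>
  have c: "\<bar>\<Sum>is\<in>midx n (m - 1). c is * \<pi> is\<bar> \<le> cmod (\<Sum>i<n ^ (m - 1). u $ i * cflatten n (m - 1) \<pi> $ i)"
    for \<pi>
  proof -
    have "(\<Sum>is\<in>midx n (m - 1). c is * \<pi> is) = Re (z * (\<Sum>i<n ^ (m - 1). u $ i * cflatten n (m - 1) \<pi> $ i))"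
      unfolding sum_midx[OF order_pos] sum_distrib_left Re_sum
    proof (rule sum.cong)
      fix i assume "i \<in> {..<n ^ (m - 1)}"
      then have i: "i < n ^ (m - 1)" by simp
      show "c (multi_index n (m - 1) i) * \<pi> (multi_index n (m - 1) i)
          = Re (z * (u $ i * cflatten n (m - 1) \<pi> $ i))"
        unfolding c_def unflatten_def ivec_multi_index[OF order_pos i] cflatten_def flatten_index[OF i]
        by (simp add: algebra_simps)
    qed simp
    also have "\<bar>\<dots>\<bar> \<le> cmod (z * (\<Sum>i<n ^ (m - 1). u $ i * cflatten n (m - 1) \<pi> $ i))"
      by (rule abs_Re_le_cmod)
    finally show ?thesis by (simp add: norm_mult z)
  qed
  let ?j = "multi_index n (m - 1) l"
  \<comment> \<open>The point mass at the multi-index of a nonzero entry of \<open>u\<close> is a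
    joint distribution off the hyperplane.\<close>
  define \<delta> where "\<delta> is = (if is = ?j then 1 else 0 :: real)" for "is"
  have j: "?j \<in> midx n (m - 1)" using multi_index_mem[OF order_pos l(1)] .
  have "joint_pmf n (m - 1) \<delta>"
    using j finite_midx[of n "m - 1"] by (simp add: joint_pmf_def \<delta>_def)
  moreover have "(\<Sum>is\<in>midx n (m - 1). c is * \<delta> is) = cmod (u $ l)"
  proof -
    have "(\<Sum>is\<in>midx n (m - 1). c is * \<delta> is) = c ?j"
      using j finite_midx[of n "m - 1"] by (simp add: \<delta>_def if_distrib cong: if_cong)
    also have "\<dots> = Re (z * u $ l)"
      unfolding c_def unflatten_def ivec_multi_index[OF order_pos l(1)] by simp
    finally show ?thesis using z(2) by simp
  qed
  moreover have "(\<lambda>t. root t (tensor_dist n (m - 1) (memory_dist n p \<pi>0 t) \<pi>')) \<longlonglongrightarrow> subdominant_modulus"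
    if \<pi>0: "joint_pmf n (m - 1) \<pi>0" "(\<Sum>is\<in>midx n (m - 1). c is * \<pi>0 is) \<noteq> 0" for \<pi>0
  proof (rule root_tendsto[OF subdominant_modulus_nonneg tensor_dist_nonneg tensor_dist_geometric[OF \<pi>0(1)]])
    let ?s = "cmod (\<Sum>i<n ^ (m - 1). u $ i * cflatten n (m - 1) \<pi>0 $ i)"
    have "?s > 0" using c[of \<pi>0] \<pi>0(2) by linarith
    moreover have "?s / M * subdominant_modulus ^ t \<le> tensor_dist n (m - 1) (memory_dist n p \<pi>0 t) \<pi>'" for t
      using ge[OF cflatten_carrier, of t \<pi>0] M unfolding tensor_dist_memory_dist
      by (simp add: field_simps)
    ultimately show "\<exists>a>0. \<forall>t. a * subdominant_modulus ^ t
        \<le> tensor_dist n (m - 1) (memory_dist n p \<pi>0 t) \<pi>'"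
      using M by (intro exI[of _ "?s / M"]) simp
  qed
  ultimately show ?thesis
    unfolding generic_joint_pmf_def using l(2)
    by (intro exI[of _ c] conjI exI[of _ \<delta>]) auto
qed

end

section \<open>Existence of the stationary tensor and the theorem\<close>

lemma ex_stationary_memory:
  assumes "n \<ge> 1" "m \<ge> 2" "transition_tensor n m p" "U_primitive n (m - 1) (paired_tensor p)"
  shows "\<exists>k \<pi>'. stationary_memory n m p k \<pi>' \<and> (\<forall>is\<in>midx n (m - 1). 0 < \<pi>' is)"
proof -
  let ?N = "n ^ (m - 1)" and ?B = "unfolding_mat n (m - 1) (paired_tensor p)"
  have L: "m - 1 \<ge> 1" using assms by simp
  obtain k where "primitive_stochastic ?N ?B k"
    using primitive_stochastic_unfolding[OF assms] by blast
  then interpret primitive_stochastic ?N ?B k .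
  obtain w where w: "w \<in> carrier_vec ?N" "cmat ?B *\<^sub>v map_vec complex_of_real w = map_vec complex_of_real w"
    "vec_total w = 1" "\<And>i. i < ?N \<Longrightarrow> 0 < w $ i"
    using ex_fixed_vec by blast
  define \<pi>' where "\<pi>' = unflatten n w"
  have eq: "\<pi>' (multi_index n (m - 1) r) = w $ r" if "r < ?N" for r
    unfolding \<pi>'_def unflatten_def ivec_multi_index[OF L that] by simp
  have pos: "\<forall>is\<in>midx n (m - 1). 0 < \<pi>' is"
    unfolding ball_midx[OF L] using eq w(4) by simp
  have "(\<Sum>is\<in>midx n (m - 1). \<pi>' is) = (\<Sum>r<?N. w $ r)"
    unfolding sum_midx[OF L] by (rule sum.cong) (auto simp: eq simp del: One_nat_def)
  then have "(\<Sum>is\<in>midx n (m - 1). \<pi>' is) = 1"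
    using w(1,3) by (simp add: vec_total_def)
  then have "joint_pmf n (m - 1) \<pi>'"
    using pos by (auto simp: joint_pmf_def less_imp_le)
  moreover have "cflatten n (m - 1) \<pi>' = map_vec complex_of_real w"
    using w(1) by (intro eq_vecI) (auto simp: cflatten_def flatten_def eq simp del: One_nat_def)
  ultimately have "stationary_memory n m p k \<pi>'"
    using w(2) assms(2) by unfold_locales auto
  then show ?thesis using pos by blast
qed

theorem theorem1:
  fixes n m :: nat and p :: "nat list \<Rightarrow> real"
  assumes "n \<ge> 1" and "m \<ge> 2"
    and "transition_tensor n m p"
    and "U_primitive n (m - 1) (paired_tensor p)"
  shows "\<exists>\<pi>' :: nat list \<Rightarrow> real.
    \<comment> \<open>Perron U-eigenvalue\<close>
    (U_eigenvalue n (m - 1) (cplx_tensor (paired_tensor p)) 1 \<and>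
     U_simple n (m - 1) (cplx_tensor (paired_tensor p)) 1 \<and>
     (\<forall>\<mu>. U_eigenvalue n (m - 1) (cplx_tensor (paired_tensor p)) \<mu> \<and> \<mu> \<noteq> 1 \<longrightarrow> cmod \<mu> < 1) \<and>
     joint_pmf n (m - 1) \<pi>' \<and>
     (\<forall>is\<in>midx n (m - 1). \<pi>' is > 0) \<and>
     U_eigentensor n (m - 1) (cplx_tensor (paired_tensor p)) 1 (\<lambda>is. complex_of_real (\<pi>' is)) \<and>
     (\<forall>Y. U_eigentensor n (m - 1) (cplx_tensor (paired_tensor p)) 1 Y \<longrightarrow>
        (\<exists>c. \<forall>is\<in>midx n (m - 1). Y is = c * complex_of_real (\<pi>' is)))) \<and>
    \<comment> \<open>convergence, and the joint laws of any realisation of the chain follow the update rule\<close>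
    ((\<forall>\<pi>0. joint_pmf n (m - 1) \<pi>0 \<longrightarrow>
        (\<forall>is\<in>midx n (m - 1). (\<lambda>t. memory_dist n p \<pi>0 t is) \<longlonglongrightarrow> \<pi>' is)) \<and>
     (\<forall>(M :: 'a measure) X. memory_chain n m p M X \<longrightarrow>
        joint_pmf n (m - 1) (memory_law M X m 0) \<and>
        (\<forall>t. \<forall>is\<in>midx n (m - 1).
           memory_law M X m t is = memory_dist n p (memory_law M X m 0) t is))) \<and>
    \<comment> \<open>stationary distribution\<close>
    (stationary_distribution n m p (state_marginal n (m - 1) \<pi>') \<and>
     (\<forall>x. stationary_distribution n m p x \<longrightarrow>
        (\<forall>i\<in>{1..n}. x i = state_marginal n (m - 1) \<pi>' i)) \<and>
     (\<forall>\<pi>0. joint_pmf n (m - 1) \<pi>0 \<longrightarrow>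
        (\<forall>i\<in>{1..n}. (\<lambda>t. state_marginal n (m - 1) (memory_dist n p \<pi>0 t) i)
           \<longlonglongrightarrow> state_marginal n (m - 1) \<pi>' i)) \<and>
     (\<forall>(M :: 'a measure) X. memory_chain n m p M X \<longrightarrow>
        (\<forall>i\<in>{1..n}. (\<lambda>t. \<P>(\<omega> in M. X (int t) \<omega> = i)) \<longlonglongrightarrow> state_marginal n (m - 1) \<pi>' i))) \<and>
    \<comment> \<open>rate of convergence\<close>
    ((\<forall>\<pi>0. joint_pmf n (m - 1) \<pi>0 \<longrightarrow>
        limsup (\<lambda>t. ereal (root t (tensor_dist n (m - 1) (memory_dist n p \<pi>0 t) \<pi>')))
          \<le> ereal (second_U_modulus n (m - 1) (cplx_tensor (paired_tensor p)))) \<and>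
     generic_joint_pmf n (m - 1) (\<lambda>\<pi>0.
        (\<lambda>t. root t (tensor_dist n (m - 1) (memory_dist n p \<pi>0 t) \<pi>'))
          \<longlonglongrightarrow> second_U_modulus n (m - 1) (cplx_tensor (paired_tensor p))))"
proof -
  obtain k \<pi>' where "stationary_memory n m p k \<pi>'" and pos: "\<forall>is\<in>midx n (m - 1). \<pi>' is > 0"
    using ex_stationary_memory[OF assms] by blast
  then interpret stationary_memory n m p k \<pi>' by blast
  have process: "memory_process M n m p X" if "memory_chain n m p M X" for M :: "'a measure" and X
    using that assms(2)
    by (simp add: memory_process_def memory_process_axioms_def memory_chain_def)
  have eigenvalue: "U_eigenvalue n (m - 1) (cplx_tensor (paired_tensor p)) 1"
    using U_eigenvalue_iff_A eigenvalue_1 by blast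
  have simple: "U_simple n (m - 1) (cplx_tensor (paired_tensor p)) 1"
    unfolding U_simple_def unfolding_mat_cplx_tensor using eigenvalue order_1 by blast
  have state: "(\<lambda>t. \<P>(\<omega> in M. X (int t) \<omega> = i)) \<longlonglongrightarrow> state_marginal n (m - 1) \<pi>' i"
    if chain: "memory_chain n m p M X" and i: "i \<in> {1..n}" for M :: "'a measure" and X i
  proof -
    interpret memory_process M n m p X using process[OF chain] .
    \<comment> \<open>The state law of any realisation is the marginal of the iteration started at
      its own memory law at time 0, so convergence of the iteration applies.\<close>
    have "\<P>(\<omega> in M. X (int t) \<omega> = i)
        = state_marginal n (m - 1) (memory_dist n p (memory_law M X m 0) t) i" for t
      unfolding state_prob_eq_marginal[OF i] state_marginal_def
      using memory_law_eq_memory_dist[OF Cons_midx[OF i]] by (intro sum.cong) auto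
    then show ?thesis using state_marginal_tendsto[OF joint_pmf_memory_law i] by simp
  qed
  show ?thesis
  proof (intro exI[of _ \<pi>'] conjI allI impI ballI; (elim conjE)?)
    show "\<pi>' is > 0" if "is \<in> midx n (m - 1)" for "is" using pos that by blast
    show "cmod \<mu> < 1" if "U_eigenvalue n (m - 1) (cplx_tensor (paired_tensor p)) \<mu>" "\<mu> \<noteq> 1" for \<mu>
      using that eigenvalue_cmod_less_1 unfolding U_eigenvalue_iff_A by blast
    show "limsup (\<lambda>t. ereal (root t (tensor_dist n (m - 1) (memory_dist n p \<pi>0 t) \<pi>')))
        \<le> ereal (second_U_modulus n (m - 1) (cplx_tensor (paired_tensor p)))"
      if "joint_pmf n (m - 1) \<pi>0" for \<pi>0
      unfolding second_U_modulus_eq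
      by (rule limsup_root_le[OF subdominant_modulus_nonneg tensor_dist_geometric[OF that]])
    show "generic_joint_pmf n (m - 1) (\<lambda>\<pi>0.
        (\<lambda>t. root t (tensor_dist n (m - 1) (memory_dist n p \<pi>0 t) \<pi>'))
          \<longlonglongrightarrow> second_U_modulus n (m - 1) (cplx_tensor (paired_tensor p)))"
      unfolding second_U_modulus_eq by (rule generic_rate)
  qed (fact eigenvalue simple pmf U_eigentensor_stationary stationary_distribution_marginal
      | erule U_eigentensor_1_unique | erule (1) memory_dist_tendsto
      | erule (1) stationary_distribution_unique | erule (1) state_marginal_tendsto | erule (1) state
      | rule memory_process.joint_pmf_memory_law, erule process
      | rule memory_process.memory_law_eq_memory_dist, erule process, assumption)+
qed

end
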